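(* Let $E$ be an elliptic curve defined over $\mathbb{Q}$ with $E(\mathbb{Q})_{\rm tors}\cong C_9$. Then $\sqrt{\Delta(E)}\notin\mathbb{Q}$.
   Context: $C_n$ is the cyclic group of order $n$; $E(\mathbb{Q})_{\rm tors}$ is the torsion subgroup of $E(\mathbb{Q})$. For a short Weierstrass model $Y^2=X^3+AX+B$ ($A,B\in\mathbb{Z}$) of $E$, $\Delta(E)=-2^4(4A^3+27B^2)$; whether $\Delta(E)$ is a square in $\mathbb{Q}$ (written $\sqrt{\Delta(E)}\in\mathbb{Q}$) does not depend on the chosen short model. *)

theory Defs
  imports
    Complex_Main
    "HOL-Algebra.Elementary_Groups"
    "HOL-Computational_Algebra.Nth_Powers"
begin

section \<open>Elliptic curves in general Weierstrass form\<close>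

text \<open>The curve \<open>y\<^sup>2 + a1 x y + a3 y = x\<^sup>3 + a2 x\<^sup>2 + a4 x + a6\<close>.\<close>

record 'a weierstrass =
  a1 :: 'a
  a2 :: 'a
  a3 :: 'a
  a4 :: 'a
  a6 :: 'a

definition weierstrass_poly :: "'a::field weierstrass \<Rightarrow> 'a \<Rightarrow> 'a \<Rightarrow> 'a" where
  "weierstrass_poly E x y =
     y^2 + a1 E * x * y + a3 E * y - (x^3 + a2 E * x^2 + a4 E * x + a6 E)"

definition discriminant :: "'a::field weierstrass \<Rightarrow> 'a" where
  "discriminant E =
     (let b2 = a1 E ^ 2 + 4 * a2 E;
          b4 = 2 * a4 E + a1 E * a3 E;
          b6 = a3 E ^ 2 + 4 * a6 E;
          b8 = a1 E ^ 2 * a6 E + 4 * a2 E * a6 E - a1 E * a3 E * a4 E + a2 E * a3 E ^ 2 - a4 E ^ 2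
      in - (b2^2 * b8) - 8 * b4^3 - 27 * b6^2 + 9 * b2 * b4 * b6)"

definition elliptic_curve :: "'a::field weierstrass \<Rightarrow> bool" where
  "elliptic_curve E \<longleftrightarrow> discriminant E \<noteq> 0"


section \<open>The group of rational points\<close>

datatype 'a point = Infinity | Affine 'a 'a

definition points :: "'a::field weierstrass \<Rightarrow> 'a point set" where
  "points E = insert Infinity {Affine x y | x y. weierstrass_poly E x y = 0}"

text \<open>Chord and tangent: the negative of \<open>(x, y)\<close> is \<open>(x, - y - a1 x - a3)\<close>, and \<open>l\<close> is the
  slope of the line through the two points (of the tangent if they coincide).\<close>

fun point_add :: "'a::field weierstrass \<Rightarrow> 'a point \<Rightarrow> 'a point \<Rightarrow> 'a point" where
  "point_add E Infinity Q = Q"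
| "point_add E P Infinity = P"
| "point_add E (Affine x1 y1) (Affine x2 y2) =
     (if x1 = x2 \<and> y2 = - y1 - a1 E * x1 - a3 E then Infinity
      else
        let l = (if x1 = x2
                 then (3 * x1^2 + 2 * a2 E * x1 + a4 E - a1 E * y1) / (2 * y1 + a1 E * x1 + a3 E)
                 else (y2 - y1) / (x2 - x1));
            x3 = l^2 + a1 E * l - a2 E - x1 - x2
        in Affine x3 (- (l * (x3 - x1) + y1) - a1 E * x3 - a3 E))"

definition mordell_weil :: "'a::field weierstrass \<Rightarrow> 'a point monoid" where
  "mordell_weil E = \<lparr>carrier = points E, monoid.mult = point_add E, one = Infinity\<rparr>"

definition torsion_points :: "'a::field weierstrass \<Rightarrow> 'a point set" where
  "torsion_points E =
     {P \<in> points E. \<exists>n::nat. n > 0 \<and> P [^]\<^bsub>mordell_weil E\<^esub> n = \<one>\<^bsub>mordell_weil E\<^esub>}"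

definition torsion_subgroup :: "'a::field weierstrass \<Rightarrow> 'a point monoid" where
  "torsion_subgroup E = (mordell_weil E)\<lparr>carrier := torsion_points E\<rparr>"


section \<open>Short Weierstrass models\<close>

text \<open>\<open>Y\<^sup>2 = X\<^sup>3 + A X + B\<close> with integral \<open>A\<close>, \<open>B\<close> is a model of \<open>E\<close> if it arises from \<open>E\<close>
  by an admissible change of variables \<open>x = u\<^sup>2 X + r\<close>, \<open>y = u\<^sup>3 Y + s u\<^sup>2 X + t\<close> over the
  rationals. Since the field is infinite, equality of the two sides for all values
  \<open>X\<close>, \<open>Y\<close> is equality of polynomials.\<close>

definition is_short_model :: "rat weierstrass \<Rightarrow> int \<Rightarrow> int \<Rightarrow> bool" where
  "is_short_model E A B \<longleftrightarrow>
     (\<exists>u r s t :: rat. u \<noteq> 0 \<and>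
        (\<forall>X Y. weierstrass_poly E (u^2 * X + r) (u^3 * Y + s * u^2 * X + t)
               = u^6 * (Y^2 - (X^3 + of_int A * X + of_int B))))"

definition short_discriminant :: "int \<Rightarrow> int \<Rightarrow> int" where
  "short_discriminant A B = - (2^4) * (4 * A^3 + 27 * B^2)"


text \<open>Every Weierstrass curve over the rationals has a short integral model, and whether the
  discriminant of such a model is a square does not depend on the model.\<close>

lemma short_model_exists: "\<exists>A B. is_short_model E A B"
proof -
  define r where "r = - (a1 E ^ 2 + 4 * a2 E) / 12"
  define s where "s = - a1 E / 2"
  define t where "t = - (a1 E * r + a3 E) / 2"
  define A0 where "A0 = 3 * r^2 + 2 * a2 E * r + a4 E - s * a3 E - (t + r * s) * a1 E - 2 * s * t"
  define B0 where "B0 = a6 E + r * a4 E + r^2 * a2 E + r^3 - t * a3 E - t^2 - r * t * a1 E"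
  obtain p q where pq: "A0 = of_int p / of_int q" "q > 0"
    by (metis quotient_of_denom_pos quotient_of_div surj_pair)
  obtain p' q' where pq': "B0 = of_int p' / of_int q'" "q' > 0"
    by (metis quotient_of_denom_pos quotient_of_div surj_pair)
  define N where "N = q * q'"
  define A where "A = p * q^3 * q'^4"
  define B where "B = p' * q^6 * q'^5"
  define u :: rat where "u = 1 / of_int N"
  have N: "N \<noteq> 0" using pq pq' by (simp add: N_def)
  have A: "of_int A * u^4 = A0"
    using pq pq' by (simp add: A_def u_def N_def field_simps power_numeral_reduce)
  have B: "of_int B * u^6 = B0"
    using pq pq' by (simp add: B_def u_def N_def field_simps power_numeral_reduce)
  have id: "weierstrass_poly E (x + r) (y + s * x + t) = y^2 - (x^3 + A0 * x + B0)" for x y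
  proof -
    have "a1 E = - 2 * s" "a3 E = - 2 * t + 2 * s * r" "a2 E = - (s^2) - 3 * r"
      by (simp_all add: s_def t_def r_def field_simps power2_eq_square)
    then show ?thesis
      unfolding weierstrass_poly_def A0_def B0_def
      by (simp only:) (simp add: algebra_simps power2_eq_square power3_eq_cube)
  qed
  have "weierstrass_poly E (u^2 * X + r) (u^3 * Y + s * u^2 * X + t)
               = u^6 * (Y^2 - (X^3 + of_int A * X + of_int B))" for X Y
    using id[of "u^2 * X" "u^3 * Y"] unfolding A[symmetric] B[symmetric]
    by (simp add: algebra_simps power_mult_distrib flip: power_mult power_add)
  moreover have "u \<noteq> 0" using N by (simp add: u_def)
  ultimately show ?thesis unfolding is_short_model_def by blast
qed

lemma short_model_discriminant:
  assumes "is_short_model E A B"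
  shows "\<exists>u. u \<noteq> 0 \<and> discriminant E = u^12 * of_int (short_discriminant A B)"
proof -
  obtain u r s t where u: "u \<noteq> 0" and eq:
    "\<And>X Y. weierstrass_poly E (u^2 * X + r) (u^3 * Y + s * u^2 * X + t)
               = u^6 * (Y^2 - (X^3 + of_int A * X + of_int B))"
    using assms unfolding is_short_model_def by blast
  define a b :: rat where "a = of_int A * u^4" and "b = of_int B * u^6"
  have id: "weierstrass_poly E (x + r) (y + s * x + t) = y^2 - (x^3 + a * x + b)" for x y
  proof -
    have [simp]: "u^2 * (x / u^2) = x" "u^3 * (y / u^3) = y" "s * u^2 * (x / u^2) = s * x"
      using u by simp_all
    have "weierstrass_poly E (x + r) (y + s * x + t)
        = u^6 * ((y / u^3)^2 - ((x / u^2)^3 + of_int A * (x / u^2) + of_int B))"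
      using eq[of "x / u^2" "y / u^3"] by (simp add: u)
    also have "\<dots> = y^2 - (x^3 + a * x + b)"
      using u by (simp add: a_def b_def field_simps power_numeral_reduce)
    finally show ?thesis .
  qed
  note W = weierstrass_poly_def
  have e: "a1 E + 2 * s = 0" "a3 E + r * a1 E + 2 * t = 0"
      "a2 E - s * a1 E + 3 * r - s^2 = 0"
      "a = 3 * r^2 + 2 * a2 E * r + a4 E - s * a3 E - (t + r * s) * a1 E - 2 * s * t"
      "b = a6 E + r * a4 E + r^2 * a2 E + r^3 - t * a3 E - t^2 - r * t * a1 E"
  proof -
    show b: "b = a6 E + r * a4 E + r^2 * a2 E + r^3 - t * a3 E - t^2 - r * t * a1 E"
      using id[of 0 0] unfolding W by (simp add: algebra_simps)
    show c3: "a3 E + r * a1 E + 2 * t = 0"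
      using id[of 0 0] id[of 0 1] unfolding W by (simp add: algebra_simps power2_eq_square)
    have "a1 E + 2 * s + (a3 E + r * a1 E + 2 * t) = 0"
      using id[of 1 0] id[of 1 1] unfolding W by (simp add: algebra_simps power2_eq_square)
    then show c1: "a1 E + 2 * s = 0" using c3 by simp
    show c2: "a2 E - s * a1 E + 3 * r - s^2 = 0"
      using id[of 1 0] id[of "-1" 0] id[of 0 0] unfolding W
      by (simp add: algebra_simps power2_eq_square power3_eq_cube)
    show "a = 3 * r^2 + 2 * a2 E * r + a4 E - s * a3 E - (t + r * s) * a1 E - 2 * s * t"
      using id[of 1 0] id[of "-1" 0] unfolding W
      by (simp add: algebra_simps power2_eq_square power3_eq_cube)
  qed
  have e1: "a1 E = - 2 * s" using e(1) by simp
  have e3: "a3 E = 2 * s * r - 2 * t" using e(2) e1 by (simp add: algebra_simps)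
  have e2: "a2 E = - (s^2) - 3 * r" using e(3) e1 by (simp add: algebra_simps power2_eq_square)
  have e4: "a4 E = a - (3 * r^2 + 2 * a2 E * r - s * a3 E - (t + r * s) * a1 E - 2 * s * t)"
    using e(4) by simp
  have e6: "a6 E = b - (r * a4 E + r^2 * a2 E + r^3 - t * a3 E - t^2 - r * t * a1 E)"
    using e(5) by simp
  have "discriminant E = - 16 * (4 * a^3 + 27 * b^2)"
    unfolding discriminant_def Let_def e6 e4 e3 e2 e1 by algebra
  also have "\<dots> = u^12 * of_int (short_discriminant A B)"
    by (simp add: a_def b_def short_discriminant_def algebra_simps power_mult_distrib
             flip: power_mult)
  finally show ?thesis using u by blast
qed

lemma short_model_square_iff:
  assumes "is_short_model E A B"
  shows "is_square (of_int (short_discriminant A B) :: rat) \<longleftrightarrow> is_square (discriminant E)"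
proof -
  obtain u where u: "u \<noteq> 0" "discriminant E = u^12 * of_int (short_discriminant A B)"
    using short_model_discriminant[OF assms] by blast
  show ?thesis
  proof
    assume "is_square (of_int (short_discriminant A B) :: rat)"
    then obtain z :: rat where z: "of_int (short_discriminant A B) = z^2"
      by (auto elim: is_nth_powerE)
    have "discriminant E = (u^6 * z)^2"
      by (simp add: u(2) z power_mult_distrib flip: power_mult)
    then show "is_square (discriminant E)" by (rule is_nth_powerI)
  next
    assume "is_square (discriminant E)"
    then obtain z where z: "discriminant E = z^2"
      by (auto elim: is_nth_powerE)
    have "(of_int (short_discriminant A B) :: rat) = (z / u^6)^2"
      using u z by (simp add: power_divide field_simps flip: power_mult)
    then show "is_square (of_int (short_discriminant A B) :: rat)" by (rule is_nth_powerI)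
  qed
qed

end

theory Submission
  imports Defs
begin

text \<open>
The idea: the curves with a point of order 9 form a one-parameter family, and asking for a square
discriminant in this family cuts out a curve of genus 3 that maps to an elliptic curve with only
two rational points. Both of these points belong to degenerate members of the family.

Let \<open>P\<close> be a point of order 9. Since \<open>8 P = - P\<close>, three successive doublings take \<open>P\<close> to \<open>- P\<close>.
Move \<open>P\<close> to the origin and its tangent to the \<open>x\<close>-axis, so that the curve becomes
\<open>y\<^sup>2 + a1 x y + a3 y = x\<^sup>3 + a2 x\<^sup>2\<close>. That the tangent at \<open>4 P\<close> passes through \<open>P\<close> is a single
equation in \<open>a1\<close>, \<open>a2\<close>, \<open>a3\<close>; it defines a rational curve and is solved by a parameter \<open>f\<close>
(\<open>order_nine_parametrization\<close>, which is Tate's normal form for the level 9). The discriminant is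
then, up to a twelfth power,
\<open>(f (f - 1))\<^sup>9 (f\<^sup>2 - f + 1)\<^sup>3 (f\<^sup>3 - 6 f\<^sup>2 + 3 f + 1)\<close>.

The three factors are semi-invariants of the substitution \<open>f \<mapsto> 1 / (1 - f)\<close> of order 3, whose
invariant is \<open>t = (f\<^sup>3 - 3 f + 1) / (f (f - 1))\<close>. With \<open>z = t - 3\<close> the product equals
\<open>z\<^sup>3 - 27\<close> times a twelfth power. So a square discriminant gives a rational point on
\<open>w\<^sup>2 = z\<^sup>3 - 27\<close>, and \<open>w = 0\<close> would make the discriminant vanish. That every rational point on
this curve has \<open>w = 0\<close> (\<open>rational_square_eq_cube_minus_27\<close>) is a Fermat descent: a further point
leads to a solution of \<open>c\<^sup>2 = a\<^sup>4 + 9 a\<^sup>2 b\<^sup>2 + 27 b\<^sup>4\<close>, and every solution of this equation leads to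
one with a smaller \<open>b\<close>.

The isomorphism with the cyclic group is a map that respects sums of torsion points. To use it
on an iterated double of \<open>P\<close>, one must know that this double is again a torsion point.
Full associativity of the group law is avoided: the special case
\<open>(Q + P) + P = Q + (P + P)\<close> (\<open>point_add_add_same\<close>) gives \<open>n (2 P) = (2 n) P\<close> by induction on \<open>n\<close>.
With the tangent at \<open>P\<close> horizontal this special case is short, because both sides can be written
in terms of the slope of the line through \<open>Q\<close> and \<open>2 P\<close>, which is \<open>x\<^sup>2 / y - a1\<close>
for \<open>Q = (x, y)\<close>.
\<close>

section \<open>Descent on the curve \<open>w\<^sup>2 = z\<^sup>3 - 27\<close>\<close>

lemma coprime_mult_eq_power_int:
  fixes x y z :: int
  assumes "coprime x y" "x > 0" "y > 0" "x * y = z ^ n"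
  obtains w where "w > 0" "x = w ^ n"
proof -
  have "nat x * nat y = nat \<bar>z\<bar> ^ n"
    using assms by (metis abs_of_pos nat_abs_mult_distrib nat_power_eq abs_ge_zero power_abs)
  moreover have "coprime (nat x) (nat y)"
    using assms by (metis coprime_int_iff int_nat_eq less_imp_le)
  ultimately have "is_nth_power n (nat x)"
    using assms is_nth_power_mult_coprime_nat_iff[of "nat x" "nat y" n] by auto
  then obtain k where k: "nat x = k ^ n" by (auto elim: is_nth_powerE)
  show thesis
  proof (cases "n = 0")
    case True
    with k assms show thesis by (intro that[of 1]) auto
  next
    case False
    have "x = int k ^ n" using k assms by (metis int_nat_eq less_imp_le of_nat_power)
    moreover have "k > 0" using \<open>x = _\<close> assms False by (intro gr0I) (auto simp: power_0_left)
    ultimately show thesis by (intro that[of "int k"]) auto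
  qed
qed

lemma coprime_int_primeI:
  fixes x y :: int
  assumes "x \<noteq> 0" "\<And>p. prime p \<Longrightarrow> p dvd x \<Longrightarrow> p dvd y \<Longrightarrow> False"
  shows "coprime x y"
proof (rule coprimeI)
  fix d assume d: "d dvd x" "d dvd y"
  show "is_unit d"
  proof (rule ccontr)
    assume "\<not> is_unit d"
    with d assms(1) obtain p where "prime p" "p dvd d"
      by (metis dvd_0_left prime_divisor_exists)
    with d assms(2) show False by (blast intro: dvd_trans)
  qed
qed

lemma prime_3_int: "prime (3::int)"
  by simp

lemma prime_dvd_27_int:
  assumes "prime (p::int)" "p dvd 27" shows "p = 3"
proof -
  have "p dvd 3 ^ 3" using assms(2) by simp
  then have "p dvd 3" using assms(1) prime_dvd_power by blast
  then show ?thesis using assms(1) by (simp add: primes_dvd_imp_eq)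
qed

lemma prime_dvd_2_int:
  assumes "prime (p::int)" "p dvd 2" shows "p = 2"
  using assms by (simp add: primes_dvd_imp_eq)

lemma three_dvd_sum_squares_int:
  fixes x y :: int
  assumes "3 dvd x^2 + y^2"
  shows "3 dvd x"
proof -
  have "x mod 3 = 0 \<or> x mod 3 = 1 \<or> x mod 3 = 2" "y mod 3 = 0 \<or> y mod 3 = 1 \<or> y mod 3 = 2"
    by presburger+
  moreover have "(x mod 3 * (x mod 3) + y mod 3 * (y mod 3)) mod 3 = 0"
    using assms unfolding power2_eq_square dvd_eq_mod_eq_0 by (metis mod_add_eq mod_mult_eq)
  ultimately show ?thesis by auto
qed

text \<open>Both steps of the descent factor \<open>27 v\<^sup>4\<close> into coprime factors. The prime 3 divides only one of
them, so this factor takes all of \<open>27\<close>, and what remains are two coprime factors of a fourth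
power.\<close>

lemma coprime_mult_eq_27_power4:
  fixes P Q v :: int
  assumes "coprime P Q" "P > 0" "Q > 0" "v > 0" "P * Q = 27 * v ^ 4"
  obtains r s where "r > 0" "s > 0" "v = r * s" "coprime r s" "\<not> 3 dvd r"
    "P = r ^ 4 \<and> Q = 27 * s ^ 4 \<or> P = 27 * s ^ 4 \<and> Q = r ^ 4"
proof -
  have main: "\<exists>r s. r > 0 \<and> s > 0 \<and> v = r * s \<and> coprime r s \<and> \<not> 3 dvd r \<and>
      P = r ^ 4 \<and> Q = 27 * s ^ 4"
    if "\<not> 3 dvd P" "coprime P Q" "P > 0" "Q > 0" "P * Q = 27 * v ^ 4" for P Q :: int
  proof -
    have "coprime (3 ^ 3) P"
      using that(1) prime_imp_coprime[OF prime_3_int] coprime_power_left_iff by blast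
    moreover have "3 ^ 3 dvd P * Q" using that(5) by simp
    ultimately have "3 ^ 3 dvd Q" by (metis coprime_dvd_mult_right_iff)
    then obtain T where T: "Q = 27 * T" by auto
    have PT: "coprime P T" using that(2) T by simp
    have "T > 0" "P * T = v ^ 4" using T that by auto
    from coprime_mult_eq_power_int[OF PT that(3) this] obtain r where r: "r > 0" "P = r ^ 4" .
    have "coprime T P" "T * P = v ^ 4" using PT \<open>P * T = _\<close> by (auto simp: ac_simps)
    from coprime_mult_eq_power_int[OF this(1) \<open>T > 0\<close> that(3) this(2)]
    obtain s where s: "s > 0" "T = s ^ 4" .
    have "(r * s) ^ 4 = v ^ 4" using \<open>P * T = _\<close> r s by (simp add: power_mult_distrib)
    then have "v = r * s" using r s assms(4) by (metis less_imp_le mult_pos_pos power_eq_imp_eq_base zero_less_numeral)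
    moreover have "coprime r s" using PT r s by simp
    moreover have "\<not> 3 dvd r" using that(1) r by (auto simp: dvd_power)
    ultimately show ?thesis using r s T by blast
  qed
  have "\<not> 3 dvd P \<or> \<not> 3 dvd Q"
    using assms(1) by (metis coprime_common_divisor_int not_prime_unit prime_3_int zdvd1_eq)
  then show thesis
    using main[of P Q] main[of Q P] assms that by (metis coprime_commute mult.commute)
qed

text \<open>The two quartics in this lemma and the next are the coverings that occur in the descents via
the two dual 2-isogenies between \<open>w\<^sup>2 = x (x\<^sup>2 + 9 x + 27)\<close> and \<open>w\<^sup>2 = x (x\<^sup>2 - 18 x - 27)\<close>.
In both lemmas, completing the square turns the quartic into a difference of two squares equal
to a constant times a fourth power, and the factors are coprime after removing powers of 2.\<close>

lemma isogenous_quartic_to_quartic: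
  fixes n u v :: int
  assumes eq: "n^2 + 18 * u^2 * v^2 + 27 * v^4 = u^4"
    and pos: "n > 0" "u > 0" "v > 0" and cop: "coprime u v" and three: "\<not> 3 dvd u"
  obtains r s where "r > 0" "s > 0" "v = r * s" "coprime r s"
    "u^2 = r^4 + 9 * r^2 * s^2 + 27 * s^4"
proof -
  define D where "D = u^2 - 9 * v^2"
  have D: "D^2 - n^2 = 108 * v^4" using eq unfolding D_def by algebra
  have "even (D^2 - n^2)" unfolding D by simp
  then have "even (D - n)" by simp
  then obtain P where P: "D - n = 2 * P" by blast
  define Q where "Q = P + n"
  have PQ: "P * Q = 27 * v^4"
  proof -
    have "4 * (P * Q) = D^2 - n^2"
      using P unfolding Q_def by algebra
    with D show ?thesis by simp
  qed
  have sum: "P + Q = D" using P Q_def by simp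
  have "0 < D"
  proof -
    have "u^2 * (u^2 - 18 * v^2) = n^2 + 27 * v^4" using eq by algebra
    moreover have "\<dots> > 0" using pos by (simp add: add_pos_pos)
    ultimately have "u^2 - 18 * v^2 > 0" using pos by (metis mult_less_0_iff order_less_asym zero_less_mult_iff zero_less_power)
    then show ?thesis using pos unfolding D_def by (smt (verit) zero_less_power)
  qed
  moreover have "P * Q > 0" using PQ pos by simp
  ultimately have PQpos: "P > 0" "Q > 0" using sum by (auto simp: zero_less_mult_iff)
  have "coprime P Q"
  proof (rule coprime_int_primeI)
    fix p assume p: "prime p" "p dvd P" "p dvd Q"
    have "p dvd 27 * v ^ 4" using p PQ by (metis dvd_mult2)
    then consider "p dvd 27" | "p dvd v"
      using p(1) by (metis prime_dvd_mult_iff prime_dvd_power)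
    then show False
    proof cases
      case 1
      then have "3 dvd P" "3 dvd Q" using prime_dvd_27_int p by auto
      then have "3 dvd u^2 - 9 * v^2" using sum unfolding D_def by (metis dvd_add)
      then have "3 dvd u^2" by presburger
      then show False using three prime_dvd_power prime_3_int by blast
    next
      case 2
      have "p dvd u^2 - 9 * v^2" using p sum unfolding D_def by (metis dvd_add)
      moreover have "p dvd 9 * v^2" using 2 by (simp add: power2_eq_square)
      ultimately have "p dvd u^2" by (metis diff_add_cancel dvd_add)
      then have "p dvd u" using p prime_dvd_power by blast
      with 2 cop p(1) show False by (meson coprime_common_divisor not_prime_unit)
    qed
  qed (use PQpos in simp)
  from coprime_mult_eq_27_power4[OF this PQpos pos(3) PQ] obtain r s where
    rs: "r > 0" "s > 0" "v = r * s" "coprime r s" "P + Q = r^4 + 27 * s^4"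
    by (metis add.commute)
  have "u^2 = r^4 + 9 * r^2 * s^2 + 27 * s^4"
    using rs(3,5) sum unfolding D_def by (simp add: power_mult_distrib)
  with rs that show thesis by blast
qed

text \<open>Here \<open>4 c\<^sup>2 - (2 a\<^sup>2 + 9 b\<^sup>2)\<^sup>2 = 27 b\<^sup>4\<close>. The left factors are coprime for odd \<open>b\<close>, and have
greatest common divisor 4 for even \<open>b\<close>. Of the two ways to split \<open>27 b\<^sup>4\<close>, the one in which the
larger factor is \<open>27 v\<^sup>4\<close> is excluded modulo 3, since it makes 3 divide a sum of two squares one of
which is prime to 3.\<close>

lemma quartic_to_isogenous_quartic:
  fixes a b c :: int
  assumes eq: "c^2 = a^4 + 9 * a^2 * b^2 + 27 * b^4"
    and pos: "a > 0" "b > 0" "c > 0" and cop: "coprime a b"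
  obtains n u v where "n > 0" "u > 0" "v > 0" "coprime u v" "\<not> 3 dvd u" "u * v \<le> b"
    "n^2 + 18 * u^2 * v^2 + 27 * v^4 = u^4"
proof -
  \<comment> \<open>Otherwise the power of 3 in the right-hand side is exactly 27, which is not a square.\<close>
  have a3: "\<not> 3 dvd a"
  proof
    assume "3 dvd a"
    then obtain a' where a': "a = 3 * a'" ..
    have "c^2 = 3 * (27 * a'^4 + 27 * a'^2 * b^2 + 9 * b^4)"
      using eq unfolding a' by (simp add: power_mult_distrib)
    then have "3 dvd c^2" by simp
    then have "3 dvd c" using prime_dvd_power prime_3_int by blast
    then obtain c' where c': "c = 3 * c'" ..
    have eq': "c'^2 = 3 * (3 * a'^4 + 3 * a'^2 * b^2 + b^4)"
      using eq unfolding a' c' by (simp add: power_mult_distrib)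
    then have "3 dvd c'^2" by simp
    then have "3 dvd c'" using prime_dvd_power prime_3_int by blast
    then obtain c'' where c'': "c' = 3 * c''" ..
    have "b^4 = 3 * (c''^2 - a'^4 - a'^2 * b^2)"
      using eq' unfolding c'' by (simp add: power_mult_distrib)
    then have "3 dvd b^4" by simp
    then have "3 dvd b" using prime_dvd_power prime_3_int by blast
    with \<open>3 dvd a\<close> cop show False by (meson coprime_common_divisor not_prime_unit prime_3_int)
  qed
  \<comment> \<open>The coprimality argument for both parities of \<open>b\<close>: \<open>w\<close> is \<open>b\<close> or \<open>b / 2\<close>, and the last
      assumption covers the prime 2, for which \<open>2 a\<^sup>2\<close> says nothing about \<open>a\<close>.\<close>
  have no_common: False
    if asm: "prime p" "p dvd 27 * w^4" "p dvd 2 * a^2 + 9 * b^2" "w dvd b" "p = 2 \<longrightarrow> p dvd b \<and> p dvd a^2" for p w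
  proof -
    consider "p dvd 27" | "p dvd w"
      using asm(1,2) by (metis prime_dvd_mult_iff prime_dvd_power)
    then show False
    proof cases
      case 1
      then have "3 dvd 2 * a^2 + 9 * b^2" using prime_dvd_27_int that by auto
      then have "3 dvd a^2" by presburger
      then show False using a3 prime_dvd_power prime_3_int by blast
    next
      case 2
      then have pb: "p dvd b" using that by (meson dvd_trans)
      then have "p dvd 9 * b^2" by (simp add: power2_eq_square)
      then have "p dvd 2 * a^2" using that(3) by (metis add_diff_cancel_right' dvd_diff)
      then have "p dvd a^2" using that(1,5) prime_dvd_2_int by (metis prime_dvd_mult_iff)
      then have "p dvd a" using that(1) prime_dvd_power by blast
      with pb cop that(1) show False by (meson coprime_common_divisor not_prime_unit)
    qed
  qed
  show thesis
  proof (cases "even b")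
    case False
    define P Q where "P = 2 * c - 2 * a^2 - 9 * b^2" and "Q = 2 * c + 2 * a^2 + 9 * b^2"
    have PQ: "P * Q = 27 * b^4" unfolding P_def Q_def using eq by algebra
    have "Q > 0" unfolding Q_def using pos by (simp add: add_pos_pos)
    moreover have "P * Q > 0" using PQ pos by simp
    ultimately have PQpos: "P > 0" "Q > 0" by (auto simp: zero_less_mult_iff)
    have "coprime P Q"
    proof (rule coprime_int_primeI)
      fix p assume p: "prime p" "p dvd P" "p dvd Q"
      have d: "p dvd 27 * b ^ 4" using p PQ by (metis dvd_mult2)
      have "odd (27 * b ^ 4)" using False by simp
      then have p2: "p \<noteq> 2" using d by blast
      have "p dvd Q - P" using p by (simp add: dvd_diff)
      also have "Q - P = 2 * (2 * a^2 + 9 * b^2)" unfolding P_def Q_def by simp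
      finally have "p dvd 2 * a^2 + 9 * b^2" using p(1) p2 prime_dvd_2_int
        by (metis prime_dvd_mult_iff)
      from no_common[OF p(1) d this] p2 show False by simp
    qed (use PQpos in simp)
    from coprime_mult_eq_27_power4[OF this PQpos pos(2) PQ] obtain u v where
      uv: "v > 0" "u > 0" "b = u * v" "coprime u v" "\<not> 3 dvd u"
       and "P = u ^ 4 \<and> Q = 27 * v ^ 4 \<or> P = 27 * v ^ 4 \<and> Q = u ^ 4" by metis
    then consider "Q - P = 27 * v^4 - u^4" | "Q - P = u^4 - 27 * v^4" by auto
    then show thesis
    proof cases
      case 1
      then have "(u^2)^2 + (2 * a)^2 = 3 * (9 * v^4 - 6 * b^2)"
        unfolding P_def Q_def by (simp add: power_mult_distrib)
      then have "3 dvd u^2" using three_dvd_sum_squares_int by (metis dvd_triv_left)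
      then show thesis using uv prime_dvd_power prime_3_int by blast
    next
      case 2
      then have "(2 * a)^2 + 18 * u^2 * v^2 + 27 * v^4 = u^4"
        unfolding P_def Q_def uv(3) by (simp add: power_mult_distrib)
      with uv pos show thesis by (intro that[of "2 * a" u v]) auto
    qed
  next
    case True
    then obtain w where w: "b = 2 * w" ..
    define D where "D = a^2 + 18 * w^2"
    have D: "c^2 - D^2 = 108 * w^4" unfolding D_def using eq unfolding w by algebra
    have "even (c^2 - D^2)" unfolding D by simp
    then have "even (c - D)" by simp
    then obtain P where P: "c - D = 2 * P" ..
    define Q where "Q = P + D"
    have PQ: "P * Q = 27 * w^4"
    proof -
      have "4 * (P * Q) = c^2 - D^2" using P unfolding Q_def by algebra
      with D show ?thesis by simp
    qed
    have wpos: "w > 0" using w pos by simp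
    have "P + Q = c" using P Q_def by simp
    moreover have "P * Q > 0" using PQ wpos by simp
    ultimately have PQpos: "P > 0" "Q > 0" using pos by (auto simp: zero_less_mult_iff)
    have "coprime P Q"
    proof (rule coprime_int_primeI)
      fix p assume p: "prime p" "p dvd P" "p dvd Q"
      have d: "p dvd 27 * w ^ 4" using p PQ by (metis dvd_mult2)
      have "p dvd Q - P" using p by (simp add: dvd_diff)
      then have pD: "p dvd D" unfolding Q_def by simp
      have "2 * a^2 + 9 * b^2 = 2 * D" unfolding D_def w by (simp add: power_mult_distrib)
      then have "p dvd 2 * a^2 + 9 * b^2" using pD by simp
      moreover have "p dvd b \<and> p dvd a^2" if "p = 2" using pD unfolding that D_def w by simp
      ultimately show False using no_common[OF p(1) d] w by simp
    qed (use PQpos in simp)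
    from coprime_mult_eq_27_power4[OF this PQpos wpos PQ] obtain u v where
      uv: "v > 0" "u > 0" "w = u * v" "coprime u v" "\<not> 3 dvd u"
       and "P = u ^ 4 \<and> Q = 27 * v ^ 4 \<or> P = 27 * v ^ 4 \<and> Q = u ^ 4" by metis
    then consider "D = 27 * v^4 - u^4" | "D = u^4 - 27 * v^4" using Q_def by force
    then show thesis
    proof cases
      case 1
      then have "(u^2)^2 + a^2 = 3 * (9 * v^4 - 6 * w^2)"
        unfolding D_def by simp
      then have "3 dvd u^2" using three_dvd_sum_squares_int by (metis dvd_triv_left)
      then show thesis using uv prime_dvd_power prime_3_int by blast
    next
      case 2
      then have "a^2 + 18 * u^2 * v^2 + 27 * v^4 = u^4"
        unfolding D_def uv(3) by (simp add: power_mult_distrib)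
      with uv pos w show thesis by (intro that[of a u v]) auto
    qed
  qed
qed

text \<open>Infinite descent on \<open>b\<close>: going through both isogenies leads back to the same equation.\<close>

theorem quartic_not_square:
  fixes a b c :: int
  assumes "a > 0" "b > 0" "coprime a b"
  shows "c^2 \<noteq> a^4 + 9 * a^2 * b^2 + 27 * b^4"
  using assms
proof (induction "nat b" arbitrary: a b c rule: less_induct)
  case less
  show ?case
  proof
    assume eq: "c^2 = a^4 + 9 * a^2 * b^2 + 27 * b^4"
    moreover have "a^4 + 9 * a^2 * b^2 + 27 * b^4 > 0" using less.prems by (simp add: add_pos_pos)
    ultimately have "c \<noteq> 0" by auto
    with eq have "\<bar>c\<bar> > 0" "\<bar>c\<bar>^2 = a^4 + 9 * a^2 * b^2 + 27 * b^4" by auto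
    from quartic_to_isogenous_quartic[OF this(2) less.prems(1,2) this(1) less.prems(3)]
    obtain n u v where nuv: "n > 0" "u > 0" "v > 0" "coprime u v" "\<not> 3 dvd u" "u * v \<le> b"
      "n^2 + 18 * u^2 * v^2 + 27 * v^4 = u^4" .
    from isogenous_quartic_to_quartic[OF nuv(7,1,2,3,4,5)] obtain r s where
      rs: "r > 0" "s > 0" "v = r * s" "coprime r s" "u^2 = r^4 + 9 * r^2 * s^2 + 27 * s^4" .
    \<comment> \<open>The identity \<open>u\<^sup>2 = r\<^sup>4 + 9 r\<^sup>2 s\<^sup>2 + 27 s\<^sup>4\<close> forces \<open>u > 1\<close>, so that \<open>s \<le> v < u v \<le> b\<close>.\<close>
    have "s < b"
    proof -
      have "s^4 > 0" using rs by simp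
      then have "u^2 > 1" using rs by (smt (verit) mult_pos_pos zero_less_power)
      then have "u > 1" using nuv(2) by (smt (verit) one_power2 power_mono)
      moreover have "s \<le> v" using rs by simp
      ultimately have "s < u * v" using rs nuv by (smt (verit) mult_less_cancel_right1)
      with nuv(6) show ?thesis by simp
    qed
    then have "nat s < nat b" using rs by simp
    from less.hyps[OF this rs(1,2,4)] rs(5) show False by blast
  qed
qed

text \<open>The point \<open>x = p / q\<close> on \<open>w\<^sup>2 = x (x\<^sup>2 + 9 x + 27)\<close>, with denominators cleared. If 3 does not
divide \<open>p\<close>, the three factors are pairwise coprime, hence squares, and give the quartic. If 3
divides \<open>p\<close>, then so does 27, and the numerator of \<open>27 / x\<close> is prime to 3; adding the
2-torsion point \<open>(0, 0)\<close> takes \<open>x\<close> to \<open>27 / x\<close>, so this case gives the same quartic with \<open>a\<close> and \<open>b\<close> exchanged.\<close>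

lemma cubic_form_not_square:
  fixes p q m :: int
  assumes "p > 0" "q > 0" "coprime p q"
  shows "m^2 \<noteq> p * q * (p^2 + 9 * p * q + 27 * q^2)"
proof
  assume eq: "m^2 = p * q * (p^2 + 9 * p * q + 27 * q^2)"
  define K where "K = p^2 + 9 * p * q + 27 * q^2"
  have K: "K > 0" unfolding K_def using assms by (simp add: add_pos_pos)
  have eqK: "q * (p * K) = m^2" "(p * K) * q = m^2" using eq unfolding K_def by (auto simp: ac_simps)
  have "coprime q K"
  proof (rule coprime_int_primeI)
    fix r assume r: "prime r" "r dvd q" "r dvd K"
    have "p^2 = K - q * (9 * p + 27 * q)" unfolding K_def by algebra
    then have "r dvd p^2" using r by simp
    then have "r dvd p" using r(1) prime_dvd_power by blast
    with r assms(3) show False by (meson coprime_common_divisor not_prime_unit)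
  qed (use assms in simp)
  then have cop: "coprime q (p * K)" "coprime (p * K) q" using assms(3) by (simp_all add: ac_simps)
  have pK: "p * K > 0" using assms K by simp
  obtain b where b: "b > 0" "q = b^2"
    using coprime_mult_eq_power_int[OF cop(1) assms(2) pK eqK(1)] .
  obtain k where k: "k > 0" "p * K = k^2"
    using coprime_mult_eq_power_int[OF cop(2) pK assms(2) eqK(2)] .
  show False
  proof (cases "3 dvd p")
    case False
    have "coprime p K"
    proof (rule coprime_int_primeI)
      fix r assume r: "prime r" "r dvd p" "r dvd K"
      have "27 * q^2 = K - p * (p + 9 * q)" unfolding K_def by algebra
      then have "r dvd 27 * q^2" using r by simp
      then consider "r dvd 27" | "r dvd q" using r(1) by (metis prime_dvd_mult_iff prime_dvd_power)
      then show False
      proof cases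
        case 1
        with r False prime_dvd_27_int show False by blast
      next
        case 2
        with r assms(3) show False by (meson coprime_common_divisor not_prime_unit)
      qed
    qed (use assms in simp)
    then have "coprime K p" by (simp add: ac_simps)
    obtain a where a: "a > 0" "p = a^2"
      using coprime_mult_eq_power_int[OF \<open>coprime p K\<close> assms(1) K k(2)] .
    obtain c where c: "K = c^2"
      using coprime_mult_eq_power_int[OF \<open>coprime K p\<close> K assms(1)] k(2) by (metis mult.commute)
    have "c^2 = a^4 + 9 * a^2 * b^2 + 27 * b^4"
      unfolding c[symmetric] K_def a b by (simp flip: power_mult)
    moreover have "coprime a b" using assms(3) a b by simp
    ultimately show False using quartic_not_square a b by blast
  next
    case True
    then obtain p1 where p1: "p = 3 * p1" ..
    \<comment> \<open>Successive divisions by 3 show that \<open>p = 9 p2\<close> and that \<open>3 p2 (3 p2\<^sup>2 + 3 p2 q + q\<^sup>2)\<close> is a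
      square.\<close>
    have "k^2 = 3 * (9 * p1 * (p1^2 + 3 * p1 * q + 3 * q^2))"
      using k(2) unfolding K_def p1 by algebra
    then have "3 dvd k^2" by simp
    then have "3 dvd k" using prime_dvd_power prime_3_int by blast
    then obtain k1 where k1: "k = 3 * k1" ..
    have k1': "k1^2 = 3 * (p1 * (p1^2 + 3 * p1 * q + 3 * q^2))"
      using k(2) unfolding K_def p1 k1 by algebra
    then have "3 dvd k1^2" by simp
    then have "3 dvd k1" using prime_dvd_power prime_3_int by blast
    then obtain k2 where k2: "k1 = 3 * k2" ..
    have k2': "p1^3 = 3 * (k2^2 - p1^2 * q - p1 * q^2)"
      using k1' unfolding k2 by algebra
    then have "3 dvd p1^3" by simp
    then have "3 dvd p1" using prime_dvd_power prime_3_int by blast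
    then obtain p2 where p2: "p1 = 3 * p2" ..
    define L where "L = 3 * p2^2 + 3 * p2 * q + q^2"
    have L: "3 * p2 * L = k2^2" using k2' unfolding p2 L_def by algebra
    have p2pos: "p2 > 0" using assms(1) unfolding p1 p2 by simp
    have Lpos: "L > 0" unfolding L_def using p2pos assms by (simp add: add_pos_pos)
    have "coprime (3 * p2) L"
    proof (rule coprime_int_primeI)
      fix r assume r: "prime r" "r dvd 3 * p2" "r dvd L"
      have "q^2 = L - 3 * p2 * (p2 + q)" unfolding L_def by algebra
      then have "r dvd q^2" using r by simp
      then have "r dvd q" using r(1) prime_dvd_power by blast
      moreover have "r dvd p" using r(2) unfolding p1 p2 by (rule dvd_mult)
      ultimately show False using r assms(3) by (meson coprime_common_divisor not_prime_unit)
    qed (use p2pos in simp)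
    then have cop': "coprime (3 * p2) L" "coprime L (3 * p2)" by (simp_all add: ac_simps)
    have "3 * p2 > 0" using p2pos by simp
    obtain g where g: "g > 0" "3 * p2 = g^2"
      using coprime_mult_eq_power_int[OF cop'(1) \<open>3 * p2 > 0\<close> Lpos L] .
    obtain c where c: "L = c^2"
      using coprime_mult_eq_power_int[OF cop'(2) Lpos \<open>3 * p2 > 0\<close>] L by (metis mult.commute)
    have "3 dvd g^2" using g(2) by (metis dvd_triv_left)
    then have "3 dvd g" using prime_dvd_power prime_3_int by blast
    then obtain a where a: "g = 3 * a" ..
    have p2a: "p2 = 3 * a^2" using g(2) unfolding a by (simp add: power_mult_distrib)
    have "c^2 = b^4 + 9 * b^2 * a^2 + 27 * a^4"
      unfolding c[symmetric] L_def p2a b by algebra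
    moreover have "coprime b a"
    proof -
      have "p = 27 * a^2" unfolding p1 p2 p2a by simp
      then show ?thesis using assms(3) b by (simp add: ac_simps)
    qed
    ultimately show False using quartic_not_square g a b by (metis zero_less_mult_pos zero_less_numeral)
  qed
qed

lemma int_square_if_rat_square:
  fixes N :: int and r :: rat
  assumes "r^2 = of_int N"
  obtains m :: int where "N = m^2"
proof -
  obtain m n where mn: "r = of_int m / of_int n" "n > 0" "coprime m n"
    by (metis quotient_of_coprime quotient_of_denom_pos quotient_of_div surj_pair)
  have "(of_int m :: rat)^2 = of_int (N * n^2)"
    using assms mn by (simp add: power_divide field_simps)
  then have eq: "m^2 = N * n^2" by (metis of_int_eq_iff of_int_power)
  then have "n^2 dvd m^2" by simp
  then have "n dvd m" by simp
  then have "n = 1" using mn by (metis coprime_common_divisor dvd_refl zdvd1_eq abs_of_pos)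
  with eq show thesis by (intro that[of m]) simp
qed

text \<open>The substitution \<open>x = z - 3\<close> moves the 2-torsion point \<open>(3, 0)\<close> to the origin:
\<open>z\<^sup>3 - 27 = x (x\<^sup>2 + 9 x + 27)\<close>. The quadratic factor is positive definite, so \<open>x > 0\<close> as soon as
\<open>w \<noteq> 0\<close>.\<close>

theorem rational_square_eq_cube_minus_27:
  fixes z w :: rat
  assumes "w^2 = z^3 - 27"
  shows "w = 0"
proof (rule ccontr)
  assume w: "w \<noteq> 0"
  obtain p q where pq: "z - 3 = of_int p / of_int q" "q > 0" "coprime p q"
    by (metis quotient_of_coprime quotient_of_denom_pos quotient_of_div surj_pair)
  define x where "x = z - 3"
  have eq: "w^2 = x * (x^2 + 9 * x + 27)" using assms unfolding x_def by algebra
  have "x^2 + 9 * x + 27 = (x + 9/2)^2 + 27/4" by (simp add: power2_eq_square algebra_simps)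
  then have "x^2 + 9 * x + 27 > 0" by (simp add: add_nonneg_pos)
  moreover have "w^2 > 0" using w by simp
  ultimately have "x > 0" using eq by (simp add: zero_less_mult_iff)
  then have p: "p > 0" using pq by (simp add: x_def zero_less_divide_iff)
  have "(w * of_int q^2)^2 = of_int (p * q * (p^2 + 9 * p * q + 27 * q^2))"
    using eq pq(1,2) unfolding x_def[symmetric]
    by (simp add: power_mult_distrib) (simp add: field_simps power2_eq_square power4_eq_xxxx)
  then obtain m where "p * q * (p^2 + 9 * p * q + 27 * q^2) = m^2"
    by (rule int_square_if_rat_square)
  with cubic_form_not_square[OF p pq(2,3), of m] show False by simp
qed

section \<open>Change of coordinates and the group law\<close>

text \<open>The curve obtained by substituting \<open>x + r\<close> for \<open>x\<close> and \<open>y + s x + t\<close> for \<open>y\<close>. Such a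
substitution can move a given point to the origin and, by the choice of \<open>s\<close>, make the tangent
there horizontal.\<close>

definition shift_curve :: "'a::field \<Rightarrow> 'a \<Rightarrow> 'a \<Rightarrow> 'a weierstrass \<Rightarrow> 'a weierstrass" where
  "shift_curve r s t E = \<lparr>
     a1 = a1 E + 2 * s,
     a2 = a2 E - s * a1 E + 3 * r - s^2,
     a3 = a3 E + r * a1 E + 2 * t,
     a4 = a4 E - s * a3 E + 2 * r * a2 E - (t + r * s) * a1 E + 3 * r^2 - 2 * s * t,
     a6 = a6 E + r * a4 E + r^2 * a2 E + r^3 - t * a3 E - t^2 - r * t * a1 E\<rparr>"

fun shift_point :: "'a::field \<Rightarrow> 'a \<Rightarrow> 'a \<Rightarrow> 'a point \<Rightarrow> 'a point" where
  "shift_point r s t Infinity = Infinity"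
| "shift_point r s t (Affine x y) = Affine (x + r) (y + s * x + t)"

lemma weierstrass_poly_shift:
  "weierstrass_poly E (x + r) (y + s * x + t) = weierstrass_poly (shift_curve r s t E) x y"
  unfolding weierstrass_poly_def shift_curve_def weierstrass.simps by algebra

lemma discriminant_shift: "discriminant (shift_curve r s t E) = discriminant (E :: 'a :: field weierstrass)"
  unfolding discriminant_def shift_curve_def weierstrass.simps Let_def by algebra

lemma shift_point_in_points:
  "shift_point r s t P \<in> points E \<longleftrightarrow> P \<in> points (shift_curve r s t E)"
  by (cases P) (simp_all add: points_def weierstrass_poly_shift)

lemma surj_shift_point: "\<exists>P. Q = shift_point r s t P"
proof (cases Q)
  case (Affine x y)
  then have "Q = shift_point r s t (Affine (x - r) (y - s * (x - r) - t))" by simp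
  then show ?thesis ..
qed (metis shift_point.simps(1))

text \<open>Because of this, the tangent slope is applied only to a doubled point, and its denominator does
not vanish there.\<close>

lemma same_x_points:
  assumes "Affine x y \<in> points E" "Affine x y' \<in> points E" "y' \<noteq> - y - a1 E * x - a3 E"
  shows "y' = y" "2 * y + a1 E * x + a3 E \<noteq> 0"
proof -
  have "(y - y') * (y + y' + a1 E * x + a3 E) = 0"
    using assms(1,2) unfolding points_def weierstrass_poly_def by simp algebra
  moreover have "y + y' + a1 E * x + a3 E \<noteq> 0" using assms(3) by (auto simp: algebra_simps add_eq_0_iff)
  ultimately show "y' = y" by simp
  then show "2 * y + a1 E * x + a3 E \<noteq> 0" using \<open>y + y' + a1 E * x + a3 E \<noteq> 0\<close> by simp
qed

definition slope :: "'a::field weierstrass \<Rightarrow> 'a \<Rightarrow> 'a \<Rightarrow> 'a \<Rightarrow> 'a \<Rightarrow> 'a" where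
  "slope E x1 y1 x2 y2 = (if x1 = x2
     then (3 * x1^2 + 2 * a2 E * x1 + a4 E - a1 E * y1) / (2 * y1 + a1 E * x1 + a3 E)
     else (y2 - y1) / (x2 - x1))"

lemma point_add_slope:
  assumes "\<not> (x1 = x2 \<and> y2 = - y1 - a1 E * x1 - a3 E)" "slope E x1 y1 x2 y2 = l"
    "x3 = l^2 + a1 E * l - a2 E - x1 - x2" "y3 = - (l * (x3 - x1) + y1) - a1 E * x3 - a3 E"
  shows "point_add E (Affine x1 y1) (Affine x2 y2) = Affine x3 y3"
  using assms unfolding slope_def by (simp add: Let_def)

text \<open>The substitution is affine and maps vertical lines to vertical lines, so it respects the
chord-tangent construction; slopes of lines change by \<open>s\<close>.\<close>

lemma point_add_shift:
  fixes E :: "'a::field weierstrass"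
  assumes "P \<in> points (shift_curve r s t E)" "Q \<in> points (shift_curve r s t E)"
  shows "point_add E (shift_point r s t P) (shift_point r s t Q)
         = shift_point r s t (point_add (shift_curve r s t E) P Q)"
proof (cases P; cases Q)
  fix x1 y1 x2 y2
  assume PQ: "P = Affine x1 y1" "Q = Affine x2 y2"
  let ?F = "shift_curve r s t E"
  have F: "a1 ?F = a1 E + 2 * s" "a2 ?F = a2 E - s * a1 E + 3 * r - s^2"
     "a3 ?F = a3 E + r * a1 E + 2 * t"
     "a4 ?F = a4 E - s * a3 E + 2 * r * a2 E - (t + r * s) * a1 E + 3 * r^2 - 2 * s * t"
    by (simp_all add: shift_curve_def)
  have opp: "y2 + s * x2 + t = - (y1 + s * x1 + t) - a1 E * (x1 + r) - a3 E \<longleftrightarrow>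
      y2 = - y1 - a1 ?F * x1 - a3 ?F" if "x1 = x2"
    unfolding F that by algebra
  show ?thesis
  proof (cases "x1 = x2 \<and> y2 = - y1 - a1 ?F * x1 - a3 ?F")
    case True
    with opp show ?thesis by (simp add: PQ)
  next
    case False
    define l where "l = slope ?F x1 y1 x2 y2"
    have sl: "slope E (x1 + r) (y1 + s * x1 + t) (x2 + r) (y2 + s * x2 + t) = l + s"
    proof (cases "x1 = x2")
      case True
      have nz: "2 * y1 + a1 ?F * x1 + a3 ?F \<noteq> 0"
        using same_x_points(2)[of x1 y1 ?F y2] assms False True PQ by blast
      have den: "2 * (y1 + s * x1 + t) + a1 E * (x1 + r) + a3 E = 2 * y1 + a1 ?F * x1 + a3 ?F"
        unfolding F by algebra
      have num: "3 * (x1 + r)^2 + 2 * a2 E * (x1 + r) + a4 E - a1 E * (y1 + s * x1 + t)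
        = (3 * x1^2 + 2 * a2 ?F * x1 + a4 ?F - a1 ?F * y1) + s * (2 * y1 + a1 ?F * x1 + a3 ?F)"
        unfolding F by algebra
      show ?thesis
        using nz True unfolding l_def slope_def den num by (simp add: add_divide_distrib)
    next
      case False
      then show ?thesis unfolding l_def slope_def by (simp add: field_simps)
    qed
    define x3 where "x3 = l^2 + a1 ?F * l - a2 ?F - x1 - x2"
    define y3 where "y3 = - (l * (x3 - x1) + y1) - a1 ?F * x3 - a3 ?F"
    have "point_add ?F P Q = Affine x3 y3"
      unfolding PQ using point_add_slope[OF False l_def[symmetric] x3_def y3_def] .
    moreover have "point_add E (shift_point r s t P) (shift_point r s t Q) =
        Affine (x3 + r) (y3 + s * x3 + t)"
      unfolding PQ shift_point.simps
    proof (rule point_add_slope[OF _ sl])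
      show "x3 + r = (l + s)^2 + a1 E * (l + s) - a2 E - (x1 + r) - (x2 + r)"
        unfolding x3_def F by algebra
      show "y3 + s * x3 + t = - ((l + s) * (x3 + r - (x1 + r)) + (y1 + s * x1 + t)) - a1 E * (x3 + r) - a3 E"
        unfolding y3_def F by algebra
    next
      show "\<not> (x1 + r = x2 + r \<and> y2 + s * x2 + t = - (y1 + s * x1 + t) - a1 E * (x1 + r) - a3 E)"
        using False opp by (metis add_right_cancel)
    qed
    ultimately show ?thesis by simp
  qed
qed simp_all

lemma point_add_commute:
  assumes "P \<in> points E" "Q \<in> points E"
  shows "point_add E P Q = point_add E Q P"
proof (cases P; cases Q)
  fix x1 y1 x2 y2
  assume PQ: "P = Affine x1 y1" "Q = Affine x2 y2"
  show ?thesis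
  proof (cases "x1 = x2")
    case True
    with same_x_points(1)[of x1 y1 E y2] assms PQ show ?thesis by auto
  next
    case False
    have sym: "(y1 - y2) / (x1 - x2) = (y2 - y1) / (x2 - x1)"
      by (metis minus_diff_eq minus_divide_divide)
    define l where "l = (y2 - y1) / (x2 - x1)"
    have l: "slope E x1 y1 x2 y2 = l" "slope E x2 y2 x1 y1 = l" "l * (x2 - x1) = y2 - y1"
      using False by (simp_all add: slope_def sym l_def)
    define x3 where "x3 = l^2 + a1 E * l - a2 E - x1 - x2"
    define y3 where "y3 = - (l * (x3 - x1) + y1) - a1 E * x3 - a3 E"
    have "y3 = - (l * (x3 - x2) + y2) - a1 E * x3 - a3 E"
      unfolding y3_def using l(3) by algebra
    moreover have "x3 = l^2 + a1 E * l - a2 E - x2 - x1" unfolding x3_def by simp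
    ultimately have "point_add E Q P = Affine x3 y3"
      unfolding PQ using False l by (intro point_add_slope[where l = l]) auto
    moreover have "point_add E P Q = Affine x3 y3"
      unfolding PQ using False l x3_def y3_def by (intro point_add_slope[where l = l]) auto
    ultimately show ?thesis by simp
  qed
qed simp_all

text \<open>Intersecting the curve with a line of slope \<open>l\<close> gives a cubic in \<open>x\<close> whose three roots have
the sum \<open>l\<^sup>2 + a1 l - a2\<close>, so the \<open>x\<close>-coordinate of the sum is the third root.\<close>

lemma point_add_closed:
  assumes "P \<in> points E" "Q \<in> points E"
  shows "point_add E P Q \<in> points E"
proof (cases P; cases Q)
  fix x1 y1 x2 y2
  assume PQ: "P = Affine x1 y1" "Q = Affine x2 y2"
  have on: "weierstrass_poly E x1 y1 = 0" "weierstrass_poly E x2 y2 = 0"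
    using assms PQ by (auto simp: points_def)
  show ?thesis
  proof (cases "x1 = x2 \<and> y2 = - y1 - a1 E * x1 - a3 E")
    case True
    then show ?thesis by (simp add: PQ points_def)
  next
    case False
    define l where "l = slope E x1 y1 x2 y2"
    define x3 where "x3 = l^2 + a1 E * l - a2 E - x1 - x2"
    define y3 where "y3 = - (l * (x3 - x1) + y1) - a1 E * x3 - a3 E"
    have "weierstrass_poly E x3 y3 = 0"
    proof (cases "x1 = x2")
      case True
      then have y: "y2 = y1" and nz: "2 * y1 + a1 E * x1 + a3 E \<noteq> 0"
        using same_x_points[of x1 y1 E y2] assms False PQ by auto
      have "l * (2 * y1 + a1 E * x1 + a3 E) = 3 * x1^2 + 2 * a2 E * x1 + a4 E - a1 E * y1"
        using nz True by (simp add: l_def slope_def)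
      then show ?thesis
        using on(1) unfolding y3_def x3_def weierstrass_poly_def True[symmetric] by algebra
    next
      case False
      then have l: "l * (x2 - x1) = y2 - y1" by (simp add: l_def slope_def)
      have "(x2 - x1) * weierstrass_poly E x3 y3 = 0"
        using on l unfolding y3_def x3_def weierstrass_poly_def by algebra
      with False show ?thesis by simp
    qed
    then show ?thesis
      unfolding PQ using point_add_slope[OF False l_def[symmetric] x3_def y3_def]
      by (simp add: points_def)
  qed
qed (use assms in simp_all)

section \<open>Adding the same point twice\<close>

lemma points_origin: "Affine 0 0 \<in> points E \<longleftrightarrow> a6 E = 0"
  by (simp add: points_def weierstrass_poly_def)

text \<open>From here to \<open>add_flat_origin_twice\<close>, the conditions \<open>a6 = 0\<close>, \<open>a4 = 0\<close>, \<open>a3 \<noteq> 0\<close>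
say that the origin lies on the curve with horizontal tangent \<open>y = 0\<close>.\<close>

lemma add_self_flat_origin:
  fixes E :: "'a :: field weierstrass"
  assumes "a4 E = 0" "a3 E \<noteq> 0"
  shows "point_add E (Affine 0 0) (Affine 0 0) = Affine (- a2 E) (a1 E * a2 E - a3 E)"
  using assms by (intro point_add_slope[where l = 0]) (auto simp: slope_def)

text \<open>The line \<open>y = m x\<close> through the origin meets the curve in points whose \<open>x\<close>-coordinates
other than 0 have the product \<open>- a3 m\<close>.\<close>

lemma add_origin_flat:
  fixes x y :: "'a :: field"
  assumes "a4 E = 0" "a6 E = 0" "Affine x y \<in> points E" "x \<noteq> 0"
  shows "point_add E (Affine x y) (Affine 0 0)
           = Affine (- a3 E * y / x^2) (a3 E * y^2 / x^3 + a1 E * a3 E * y / x^2 - a3 E)"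
proof (rule point_add_slope[where l = "y / x"])
  have on: "y^2 + a1 E * x * y + a3 E * y = x^3 + a2 E * x^2"
    using assms by (simp add: points_def weierstrass_poly_def)
  show "slope E x y 0 0 = y / x" using assms by (simp add: slope_def)
  show x3: "- a3 E * y / x^2 = (y / x)^2 + a1 E * (y / x) - a2 E - x - 0"
    using on assms(4) by (simp add: field_simps power2_eq_square power3_eq_cube)
  show "a3 E * y^2 / x^3 + a1 E * a3 E * y / x^2 - a3 E
    = - (y / x * (- a3 E * y / x^2 - x) + y) - a1 E * (- a3 E * y / x^2) - a3 E"
    using assms(4) by (simp add: field_simps power2_eq_square power3_eq_cube)
qed (use assms in auto)

text \<open>The slope \<open>l = x\<^sup>2 / y - a1\<close> is that of the chord from \<open>(x, y)\<close> to the double of the origin,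
since the equation of the curve can be written as
\<open>(y - a1 a2 + a3) y = (x + a2) (x\<^sup>2 - a1 y)\<close>. The formula stays valid when the two points
coincide, as it then gives the slope of the tangent.\<close>

lemma add_double_flat_origin:
  fixes x y :: "'a :: field"
  assumes "a4 E = 0" "a6 E = 0" "a3 E \<noteq> 0" "Affine x y \<in> points E" "y \<noteq> 0"
    and l: "l = x^2 / y - a1 E"
  shows "point_add E (Affine x y) (Affine (- a2 E) (a1 E * a2 E - a3 E))
           = Affine (l^2 + a1 E * l - x) (- (l * (l^2 + a1 E * l - x - x) + y) - a1 E * (l^2 + a1 E * l - x) - a3 E)"
proof (rule point_add_slope[where l = l])
  have on: "y^2 + a1 E * x * y + a3 E * y = x^3 + a2 E * x^2"
    using assms by (simp add: points_def weierstrass_poly_def)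
  show "\<not> (x = - a2 E \<and> a1 E * a2 E - a3 E = - y - a1 E * x - a3 E)"
    using assms(5) by auto
  show "slope E x y (- a2 E) (a1 E * a2 E - a3 E) = l"
  proof (cases "x = - a2 E")
    case True
    have "y * (y - (a1 E * a2 E - a3 E)) = 0" using on unfolding True by algebra
    then have y: "y = a1 E * a2 E - a3 E" using assms(5) by simp
    have den: "2 * y + a1 E * x + a3 E = y" unfolding True y by algebra
    have num: "3 * x^2 + 2 * a2 E * x + a4 E - a1 E * y = x^2 - a1 E * y"
      unfolding assms(1) True by algebra
    show ?thesis unfolding slope_def den num l using True assms(5) by (simp add: diff_divide_distrib)
  next
    case False
    then have "- a2 E - x \<noteq> 0" by (metis eq_iff_diff_eq_0)
    have "l * y = x^2 - a1 E * y" using assms(5) by (simp add: l left_diff_distrib)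
    then have "y * (l * (- a2 E - x)) = y * (a1 E * a2 E - a3 E - y)" using on by algebra
    then have "l * (- a2 E - x) = a1 E * a2 E - a3 E - y" using assms(5) by simp
    with \<open>- a2 E - x \<noteq> 0\<close> False show ?thesis by (simp add: slope_def nonzero_divide_eq_eq)
  qed
qed simp_all

text \<open>With \<open>l = x\<^sup>2 / y - a1\<close> as the slope for the right-hand side, adding the origin to \<open>Q = (x, y)\<close>
gives a point \<open>(X, Y)\<close> with \<open>- a3 / X = x\<^sup>2 / y\<close> and \<open>Y / X = l - y / x\<close>. A second addition
yields the \<open>x\<close>-coordinate \<open>(- a3 / X) (Y / X) = l\<^sup>2 + a1 l - x\<close>, which is that of the right-hand
side. The points with \<open>y = 0\<close>, where \<open>l\<close> is not defined, are the origin and the negative of its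
double; for \<open>x = 0\<close> the point \<open>Q\<close> is the negative of the origin.\<close>

lemma add_flat_origin_twice:
  fixes E :: "'a :: field weierstrass"
  assumes E: "a4 E = 0" "a6 E = 0" "a3 E \<noteq> 0" and Q: "Q \<in> points E"
  shows "point_add E (point_add E Q (Affine 0 0)) (Affine 0 0)
       = point_add E Q (point_add E (Affine 0 0) (Affine 0 0))"
proof (cases Q)
  case Infinity
  then show ?thesis by simp
next
  case [simp]: (Affine x y)
  note dbl = add_self_flat_origin[OF E(1,3)]
  have on: "y^2 + a1 E * x * y + a3 E * y = x^3 + a2 E * x^2"
    using Q E by (simp add: points_def weierstrass_poly_def)
  show ?thesis
  proof (cases "y = 0")
    case True
    then have "x^2 * (x + a2 E) = 0" using on by algebra
    then consider "x = 0" | "x = - a2 E" "x \<noteq> 0" by (auto simp: eq_neg_iff_add_eq_0)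
    then show ?thesis
    proof cases
      case 1
      have "Affine 0 0 \<in> points E" using E by (simp add: points_origin)
      then show ?thesis using 1 True
        by (simp add: point_add_commute point_add_closed del: point_add.simps)
    next
      case 2
      have "point_add E Q (Affine 0 0) = Affine 0 (- a3 E)"
        using add_origin_flat[OF E(1,2), of x y] Q 2 True by (simp del: point_add.simps)
      then show ?thesis unfolding dbl using 2 True by simp
    qed
  next
    case False
    define l where "l = x^2 / y - a1 E"
    note rhs = add_double_flat_origin[OF E, of x y l, OF _ False l_def]
    show ?thesis
    proof (cases "x = 0")
      case True
      have "y * (y + a3 E) = 0" using on True by algebra
      then have y: "y = - a3 E" using False by (simp add: eq_neg_iff_add_eq_0)
      have "point_add E Q (Affine 0 0) = Infinity" using True y by simp
      moreover have "point_add E Q (Affine (- a2 E) (a1 E * a2 E - a3 E)) = Affine 0 0"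
        using rhs Q unfolding Affine l_def True y
        by (simp add: power2_eq_square del: point_add.simps)
      ultimately show ?thesis unfolding dbl by simp
    next
      case x: False
      define X Y where "X = - a3 E * y / x^2" and "Y = a3 E * y^2 / x^3 + a1 E * a3 E * y / x^2 - a3 E"
      have XY: "point_add E Q (Affine 0 0) = Affine X Y"
        using add_origin_flat[OF E(1,2), of x y] Q x unfolding Affine X_def Y_def by blast
      have "Affine X Y \<in> points E"
        using point_add_closed[OF Q, of "Affine 0 0"] XY E by (simp add: points_origin del: point_add.simps)
      moreover have "X \<noteq> 0" using E False x by (simp add: X_def)
      ultimately have S: "point_add E (Affine X Y) (Affine 0 0) =
          Affine (- a3 E * Y / X^2) (a3 E * Y^2 / X^3 + a1 E * a3 E * Y / X^2 - a3 E)"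
        using add_origin_flat[OF E(1,2)] by blast
      define m q where "m = y / x" and "q = x^2 / y"
      have lq: "l = q - a1 E" and mx: "m * x = y" and qm: "q * m = x"
        using False x by (simp_all add: l_def m_def q_def power2_eq_square)
      have aX: "- a3 E / X = q" using E False x unfolding X_def q_def by simp
      have "Y = - (m * X) - a1 E * X - a3 E"
        by (simp add: X_def Y_def m_def power2_eq_square power3_eq_cube mult.assoc)
      then have "Y / X = - m - a1 E + (- a3 E / X)"
        using \<open>X \<noteq> 0\<close> by (simp add: diff_divide_distrib)
      then have YX: "Y / X = l - m" unfolding aX lq by simp
      have "- a3 E * Y / X^2 = (- a3 E / X) * (Y / X)" by (simp add: power2_eq_square)
      also have "\<dots> = l^2 + a1 E * l - x" unfolding aX YX using lq qm by algebra
      finally have X2: "- a3 E * Y / X^2 = l^2 + a1 E * l - x" .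
      have "a3 E * Y^2 / X^3 + a1 E * a3 E * Y / X^2 - a3 E =
          - ((- a3 E * Y / X^2) * (Y / X)) - a1 E * (- a3 E * Y / X^2) - a3 E"
        by (simp add: power2_eq_square power3_eq_cube mult.assoc)
      also have "\<dots> = - (l * (l^2 + a1 E * l - x - x) + y) - a1 E * (l^2 + a1 E * l - x) - a3 E"
        unfolding X2 YX using lq qm mx by algebra
      finally have Y2: "a3 E * Y^2 / X^3 + a1 E * a3 E * Y / X^2 - a3 E
          = - (l * (l^2 + a1 E * l - x - x) + y) - a1 E * (l^2 + a1 E * l - x) - a3 E" .
      have "point_add E Q (Affine (- a2 E) (a1 E * a2 E - a3 E)) = point_add E (Affine X Y) (Affine 0 0)"
        unfolding S X2 Y2 unfolding Affine by (rule rhs) (use Q in simp)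
      then show ?thesis unfolding XY dbl by (rule sym)
    qed
  qed
qed

text \<open>Here the origin has order 2, and adding it is the involution
\<open>(x, m x) \<mapsto> (a4 / x, (- m - a1) (a4 / x))\<close>.\<close>

lemma add_two_torsion_origin_twice:
  fixes E :: "'a :: field weierstrass"
  assumes E: "a3 E = 0" "a6 E = 0" "a4 E \<noteq> 0" and Q: "Q \<in> points E"
  shows "point_add E (point_add E Q (Affine 0 0)) (Affine 0 0) = Q"
proof (cases Q)
  case Infinity
  then show ?thesis using E by simp
next
  case [simp]: (Affine x y)
  have on: "y^2 + a1 E * x * y = x^3 + a2 E * x^2 + a4 E * x"
    using Q E by (simp add: points_def weierstrass_poly_def)
  show ?thesis
  proof (cases "x = 0")
    case True
    then show ?thesis using on E by simp
  next
    case False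
    define m where "m = y / x"
    have y: "y = m * x" using False by (simp add: m_def)
    have eq: "m^2 * x + a1 E * m * x = x^2 + a2 E * x + a4 E"
    proof -
      have "x * (m^2 * x + a1 E * m * x) = x * (x^2 + a2 E * x + a4 E)"
        using on unfolding y by algebra
      then show ?thesis using False by simp
    qed
    define X where "X = a4 E / x"
    have X: "X \<noteq> 0" using E False by (simp add: X_def)
    have Xx: "X * x = a4 E" using False by (simp add: X_def)
    have X': "X = m^2 + a1 E * m - a2 E - x"
    proof -
      have "x * X = x * (m^2 + a1 E * m - a2 E - x)" using eq Xx by algebra
      then show ?thesis using False by simp
    qed
    define Y where "Y = - (m * X) - a1 E * X"
    have "point_add E Q (Affine 0 0) = Affine X Y"
      unfolding Affine
    proof (rule point_add_slope[where l = m])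
      show "slope E x y 0 0 = m" using False by (simp add: slope_def m_def)
      show "Y = - (m * (X - x) + y) - a1 E * X - a3 E" unfolding Y_def y E by algebra
    qed (use False X' in auto)
    moreover have "point_add E (Affine X Y) (Affine 0 0) = Affine x y"
    proof (rule point_add_slope[where l = "- m - a1 E"])
      show "slope E X Y 0 0 = - m - a1 E"
        using X unfolding slope_def Y_def by (simp add: field_simps)
      show "x = (- m - a1 E)^2 + a1 E * (- m - a1 E) - a2 E - X - 0"
        using X' by algebra
      show "y = - ((- m - a1 E) * (x - X) + Y) - a1 E * x - a3 E"
        unfolding E y Y_def by algebra
    qed (use X in auto)
    ultimately show ?thesis by simp
  qed
qed

text \<open>The quantity \<open>a3 + x a1 + 2 y\<close> is the derivative in the direction of \<open>y\<close> at the point. If it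
is not 0, the tangent is not vertical, and \<open>s\<close> is its slope. If it is 0, the point has
order 2, and \<open>a4\<close> cannot vanish as well because the origin would be singular.\<close>

lemma normalize_at_point:
  fixes E :: "'a :: field weierstrass"
  assumes "elliptic_curve E" "Affine x y \<in> points E"
  obtains s F where "F = shift_curve x s y E" "a6 F = 0" "a3 F \<noteq> 0" "a4 F = 0"
  | s F where "F = shift_curve x s y E" "a6 F = 0" "a3 F = 0" "a4 F \<noteq> 0"
proof -
  have a6: "a6 (shift_curve x s y E) = 0" for s
  proof -
    have "a6 (shift_curve x s y E) = - weierstrass_poly E x y"
      by (simp add: weierstrass_poly_def shift_curve_def algebra_simps power2_eq_square)
    then show ?thesis using assms(2) by (simp add: points_def)
  qed
  define w where "w = a3 E + x * a1 E + 2 * y"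
  have a3: "a3 (shift_curve x s y E) = w" for s
    by (simp add: w_def shift_curve_def)
  show thesis
  proof (cases "w = 0")
    case True
    have "discriminant (shift_curve x 0 y E) \<noteq> 0"
      using assms(1) by (simp add: elliptic_curve_def discriminant_shift)
    then have "a4 (shift_curve x 0 y E) \<noteq> 0"
      using a6[of 0] a3[of 0] True by (intro notI) (simp add: discriminant_def Let_def)
    with that(2)[OF refl a6[of 0]] a3[of 0] True show thesis by simp
  next
    case False
    define s where "s = (a4 E + 2 * x * a2 E - y * a1 E + 3 * x^2) / w"
    have "s * w = a4 E + 2 * x * a2 E - y * a1 E + 3 * x^2" using False by (simp add: s_def)
    moreover have "a4 (shift_curve x s y E) = (a4 E + 2 * x * a2 E - y * a1 E + 3 * x^2) - s * w"
      unfolding shift_curve_def weierstrass.simps w_def by (simp add: algebra_simps)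
    ultimately have "a4 (shift_curve x s y E) = 0" by simp
    with that(1)[OF refl a6[of s]] a3[of s] False show thesis by simp
  qed
qed

text \<open>The part of the associative law needed to compare multiples of a point with multiples of its
double.\<close>

theorem point_add_add_same:
  fixes E :: "'a :: field weierstrass"
  assumes E: "elliptic_curve E" and P: "P \<in> points E" and Q: "Q \<in> points E"
  shows "point_add E (point_add E Q P) P = point_add E Q (point_add E P P)"
proof (cases P)
  case Infinity
  then show ?thesis by (cases Q) simp_all
next
  case [simp]: (Affine x y)
  have *: ?thesis if F: "F = shift_curve x s y E" and a6: "a6 F = 0" and
    eq: "\<And>R. R \<in> points F \<Longrightarrow> point_add F (point_add F R (Affine 0 0)) (Affine 0 0)
       = point_add F R (point_add F (Affine 0 0) (Affine 0 0))" for F s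
  proof -
    obtain R where R: "Q = shift_point x s y R" using surj_shift_point by blast
    have pts: "R \<in> points F" "Affine 0 0 \<in> points F"
      using Q a6 unfolding R F by (simp_all add: shift_point_in_points points_origin)
    have PP: "P = shift_point x s y (Affine 0 0)" by simp
    show ?thesis unfolding PP R
      using pts eq[OF pts(1)] unfolding F
      by (simp add: point_add_shift point_add_closed del: point_add.simps shift_point.simps)
  qed
  from P have "Affine x y \<in> points E" by simp
  with E show ?thesis
  proof (cases rule: normalize_at_point)
    case (1 s F)
    show ?thesis by (rule *[OF 1(1,2)]) (rule add_flat_origin_twice[OF 1(4,2,3)])
  next
    case (2 s F)
    have inf: "point_add F R (point_add F (Affine 0 0) (Affine 0 0)) = R" for R
      using 2(3) by (cases R) simp_all
    show ?thesis
    proof (rule *[OF 2(1,2)])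
      fix R assume "R \<in> points F"
      from add_two_torsion_origin_twice[OF 2(3,2,4) this]
      show "point_add F (point_add F R (Affine 0 0)) (Affine 0 0)
          = point_add F R (point_add F (Affine 0 0) (Affine 0 0))"
        unfolding inf .
    qed
  qed
qed

section \<open>Torsion points\<close>

fun point_neg :: "'a::field weierstrass \<Rightarrow> 'a point \<Rightarrow> 'a point" where
  "point_neg E Infinity = Infinity"
| "point_neg E (Affine x y) = Affine x (- y - a1 E * x - a3 E)"

lemma infinity_in_points: "Infinity \<in> points E"
  by (simp add: points_def)

lemma point_neg_in_points:
  assumes "P \<in> points E"
  shows "point_neg E P \<in> points E"
proof (cases P)
  case (Affine x y)
  have "weierstrass_poly E x (- y - a1 E * x - a3 E) = weierstrass_poly E x y"
    unfolding weierstrass_poly_def by algebra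
  then show ?thesis using assms by (simp add: Affine points_def)
qed (use assms in simp)

lemma point_add_neg: "point_add E P (point_neg E P) = Infinity"
  by (cases P) simp_all

text \<open>The negation is an affine symmetry of the curve that maps a line of slope \<open>l\<close> to one of
slope \<open>- l - a1\<close>.\<close>

lemma point_neg_add:
  assumes "P \<in> points E" "Q \<in> points E"
  shows "point_neg E (point_add E P Q) = point_add E (point_neg E P) (point_neg E Q)"
proof (cases P; cases Q)
  fix x1 y1 x2 y2
  assume PQ: "P = Affine x1 y1" "Q = Affine x2 y2"
  define y1' y2' where y': "y1' = - y1 - a1 E * x1 - a3 E" "y2' = - y2 - a1 E * x2 - a3 E"
  show ?thesis
  proof (cases "x1 = x2 \<and> y2 = - y1 - a1 E * x1 - a3 E")
    case True
    then show ?thesis by (simp add: PQ)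
  next
    case False
    define l where "l = slope E x1 y1 x2 y2"
    have sl: "slope E x1 y1' x2 y2' = - l - a1 E"
    proof (cases "x1 = x2")
      case True
      have nz: "2 * y1 + a1 E * x1 + a3 E \<noteq> 0"
        using same_x_points(2)[of x1 y1 E y2] assms False True PQ by blast
      have den: "2 * y1' + a1 E * x1 + a3 E = - (2 * y1 + a1 E * x1 + a3 E)"
        unfolding y' by algebra
      have num: "3 * x1^2 + 2 * a2 E * x1 + a4 E - a1 E * y1'
        = (3 * x1^2 + 2 * a2 E * x1 + a4 E - a1 E * y1) + a1 E * (2 * y1 + a1 E * x1 + a3 E)"
        unfolding y' by algebra
      show ?thesis
        using nz True unfolding l_def slope_def den num
        by (simp add: add_divide_distrib del: minus_add_distrib)
    next
      case False
      then have "x2 - x1 \<noteq> 0" by simp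
      moreover have "y2' - y1' = - (y2 - y1) - a1 E * (x2 - x1)" unfolding y' by algebra
      ultimately show ?thesis using False unfolding l_def slope_def
        by (simp add: diff_divide_distrib)
    qed
    define x3 where "x3 = l^2 + a1 E * l - a2 E - x1 - x2"
    define y3 where "y3 = - (l * (x3 - x1) + y1) - a1 E * x3 - a3 E"
    have "point_add E P Q = Affine x3 y3"
      unfolding PQ using point_add_slope[OF False l_def[symmetric] x3_def y3_def] .
    moreover have "point_add E (point_neg E P) (point_neg E Q) = Affine x3 (- y3 - a1 E * x3 - a3 E)"
      unfolding PQ point_neg.simps y'[symmetric]
    proof (rule point_add_slope[OF _ sl])
      show "\<not> (x1 = x2 \<and> y2' = - y1' - a1 E * x1 - a3 E)"
      proof
        assume "x1 = x2 \<and> y2' = - y1' - a1 E * x1 - a3 E"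
        then have "x1 = x2" and "y2' = - y1' - a1 E * x1 - a3 E" by blast+
        then have "y2' = y1" unfolding y'(1) by simp
        moreover have "y2 = - y2' - a1 E * x2 - a3 E" unfolding y'(2) by simp
        ultimately have "y2 = - y1 - a1 E * x1 - a3 E" using \<open>x1 = x2\<close> by simp
        with \<open>x1 = x2\<close> have "x1 = x2 \<and> y2 = - y1 - a1 E * x1 - a3 E" by blast
        with False show False by blast
      qed
      show "x3 = (- l - a1 E)^2 + a1 E * (- l - a1 E) - a2 E - x1 - x2"
        unfolding x3_def by algebra
      show "- y3 - a1 E * x3 - a3 E = - ((- l - a1 E) * (x3 - x1) + y1') - a1 E * x3 - a3 E"
        unfolding y3_def y' by algebra
    qed
    ultimately show ?thesis by simp
  qed
qed simp_all

abbreviation point_mult :: "'a::field weierstrass \<Rightarrow> nat \<Rightarrow> 'a point \<Rightarrow> 'a point" where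
  "point_mult E n P \<equiv> P [^]\<^bsub>mordell_weil E\<^esub> n"

lemma mordell_weil_mult [simp]: "monoid.mult (mordell_weil E) = point_add E"
  and mordell_weil_one [simp]: "\<one>\<^bsub>mordell_weil E\<^esub> = Infinity"
  by (simp_all add: mordell_weil_def)

lemma point_mult_0: "point_mult E 0 P = Infinity"
  and point_mult_Suc: "point_mult E (Suc n) P = point_add E (point_mult E n P) P"
  by (simp_all add: nat_pow_def)

lemma point_mult_in_points: "P \<in> points E \<Longrightarrow> point_mult E n P \<in> points E"
  by (induction n) (simp_all add: point_mult_0 point_mult_Suc point_add_closed infinity_in_points)

lemma point_mult_neg: "P \<in> points E \<Longrightarrow> point_mult E n (point_neg E P) = point_neg E (point_mult E n P)"
  by (induction n) (simp_all add: point_mult_0 point_mult_Suc point_neg_add point_mult_in_points)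

lemma point_mult_double:
  fixes E :: "'a :: field weierstrass"
  assumes "elliptic_curve E" "P \<in> points E"
  shows "point_mult E n (point_add E P P) = point_mult E (2 * n) P"
  using assms
  by (induction n) (simp_all add: point_mult_0 point_mult_Suc point_add_add_same point_mult_in_points)

lemma torsion_points_iff:
  "P \<in> torsion_points E \<longleftrightarrow> P \<in> points E \<and> (\<exists>n>0. point_mult E n P = Infinity)"
  by (simp add: torsion_points_def)

lemma torsion_points_neg: "P \<in> torsion_points E \<Longrightarrow> point_neg E P \<in> torsion_points E"
  unfolding torsion_points_iff by (auto simp: point_neg_in_points point_mult_neg)

text \<open>If \<open>n P = 0\<close> then \<open>n (2 P) = (2 n) P = 0\<close>, since the sequence of multiples starts again after
\<open>n\<close> steps.\<close>

lemma torsion_points_double: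
  fixes E :: "'a :: field weierstrass"
  assumes "elliptic_curve E" "P \<in> torsion_points E"
  shows "point_add E P P \<in> torsion_points E"
proof -
  from assms(2) obtain n where n: "P \<in> points E" "n > 0" "point_mult E n P = Infinity"
    unfolding torsion_points_iff by blast
  have "point_mult E (n + k) P = point_mult E k P" for k
    using n(3) by (induction k) (simp_all add: point_mult_0 point_mult_Suc)
  from this[of n] have "point_mult E n (point_add E P P) = Infinity"
    using n point_mult_double[OF assms(1) n(1), of n] by (simp add: mult_2)
  then show ?thesis unfolding torsion_points_iff using n point_add_closed by blast
qed

text \<open>Doubling a generator three times multiplies it by \<open>8\<close>, that is, by \<open>- 1\<close> modulo 9. Only doubles
and negatives are formed, because these are known to remain torsion points.\<close>

lemma torsion_C9_doubling_cycle:
  fixes E :: "'a :: field weierstrass"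
  assumes "elliptic_curve E" "torsion_subgroup E \<cong> integer_mod_group 9"
  defines "D \<equiv> \<lambda>R. point_add E R R"
  obtains P where "P \<in> points E" "D (D (D P)) = point_neg E P"
    "D P \<noteq> point_neg E P" "D P \<noteq> Infinity" "D (D P) \<noteq> Infinity" "D (D P) \<noteq> P"
proof -
  from assms(2) obtain h where "h \<in> iso (torsion_subgroup E) (integer_mod_group 9)"
    unfolding is_iso_def by blast
  then have hom: "\<And>P Q. P \<in> torsion_points E \<Longrightarrow> Q \<in> torsion_points E \<Longrightarrow>
        h (point_add E P Q) = (h P + h Q) mod 9"
      and bij: "bij_betw h (torsion_points E) {0..<9}"
    by (simp_all add: iso_def hom_def torsion_subgroup_def mordell_weil_def carrier_integer_mod_group)
  have "(1::int) \<in> {0..<9}" by simp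
  then obtain P where P: "P \<in> torsion_points E" "h P = 1"
    using bij by (metis bij_betw_imp_surj_on imageE)
  have inf: "Infinity \<in> torsion_points E"
    unfolding torsion_points_iff by (auto simp: points_def point_mult_Suc point_mult_0 intro!: exI[of _ 1])
  have range: "0 \<le> h R \<and> h R < 9" if "R \<in> torsion_points E" for R
    using bij that by (auto simp: bij_betw_def)
  have h0: "h Infinity = 0"
    using hom[OF inf inf] range[OF inf] by simp presburger
  have neg: "point_neg E P \<in> torsion_points E" using P torsion_points_neg by blast
  have hneg: "h (point_neg E P) = 8"
    using hom[OF P(1) neg] range[OF neg] P(2) h0 unfolding point_add_neg by presburger
  have D: "D R \<in> torsion_points E" "h (D R) = (2 * h R) mod 9" if "R \<in> torsion_points E" for R
    using that hom torsion_points_double[OF assms(1)] by (simp_all add: D_def)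
  have "D P \<in> torsion_points E" "h (D P) = 2" using D[OF P(1)] P by simp_all
  moreover from this have "D (D P) \<in> torsion_points E" "h (D (D P)) = 4" using D[of "D P"] by simp_all
  moreover from this have "D (D (D P)) \<in> torsion_points E" "h (D (D (D P))) = 8" using D[of "D (D P)"] by simp_all
  moreover from this have "D (D (D P)) = point_neg E P"
    using bij neg hneg by (metis bij_betw_imp_inj_on inj_onD)
  ultimately show thesis
    using P hneg h0 torsion_points_iff that by (metis numeral_eq_iff num.distinct(1,3) num.inject(1) one_eq_numeral_iff zero_neq_numeral)
qed

section \<open>Curves with a point of order 9\<close>

text \<open>The point \<open>2 P = (- a2, a1 a2 - a3)\<close> has a double \<open>4 P = (x4, y4)\<close> with
\<open>y4 = - k (x4 + a2)\<close>. As \<open>8 P = - P\<close>, the tangent at \<open>4 P\<close> passes through the origin, say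
with equation \<open>y = m x\<close>. The \<open>x\<close>-coordinates other than 0 of its intersections with the curve have
the product \<open>- a3 m\<close>, and both equal \<open>x4\<close>. Thus \<open>x4\<^sup>2 = - a3 m\<close>, or \<open>x4\<^sup>3 = - a3 y4\<close>.\<close>

lemma order_nine_relation:
  fixes F :: "'a :: field weierstrass" and k x4 :: 'a
  assumes F: "a4 F = 0" "a6 F = 0" "a3 F \<noteq> 0"
  defines "D \<equiv> \<lambda>R. point_add F R R"
  assumes D: "D (D (D (Affine 0 0))) = Affine 0 (- a3 F)" "D (Affine 0 0) \<noteq> Affine 0 (- a3 F)"
    "D (D (Affine 0 0)) \<noteq> Infinity" "D (D (Affine 0 0)) \<noteq> Affine 0 0"
  assumes k: "k = a2 F ^ 2 / (a1 F * a2 F - a3 F)" and x4: "x4 = k^2 - a1 F * k + a2 F"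
  shows "a2 F \<noteq> 0" "a1 F * a2 F - a3 F \<noteq> 0" "x4 \<noteq> 0" "x4^3 = a3 F * k * (x4 + a2 F)"
proof -
  define y2 where "y2 = a1 F * a2 F - a3 F"
  have D1: "D (Affine 0 0) = Affine (- a2 F) y2"
    unfolding D_def y2_def using add_self_flat_origin F by blast
  show a2: "a2 F \<noteq> 0" using D(2) unfolding D1 by (auto simp: y2_def)
  have y2: "y2 \<noteq> 0"
  proof
    assume "y2 = 0"
    then have "D (Affine (- a2 F) y2) = Infinity" unfolding D_def using y2_def by auto
    with D(3) D1 show False by simp
  qed
  then show "a1 F * a2 F - a3 F \<noteq> 0" unfolding y2_def .
  have k2: "k * y2 = a2 F ^ 2" using y2 unfolding k y2_def[symmetric] by simp
  define l where "l = (- a2 F)^2 / y2 - a1 F"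
  have l: "l = k - a1 F" by (simp add: l_def k y2_def)
  define y4 where "y4 = - k * (x4 + a2 F)"
  have "Affine 0 0 \<in> points F" using F by (simp add: points_origin)
  then have P2: "Affine (- a2 F) y2 \<in> points F" using D1 point_add_closed unfolding D_def by metis
  have "D (Affine (- a2 F) y2) = Affine (l^2 + a1 F * l - (- a2 F))
      (- (l * (l^2 + a1 F * l - (- a2 F) - (- a2 F)) + y2) - a1 F * (l^2 + a1 F * l - (- a2 F)) - a3 F)"
    unfolding D_def using add_double_flat_origin[OF F P2 y2 l_def] y2_def by simp
  moreover have X: "l^2 + a1 F * l - (- a2 F) = x4" unfolding l x4 by algebra
  moreover have "- (l * (x4 - (- a2 F)) + y2) - a1 F * x4 - a3 F = y4"
    unfolding l y4_def y2_def by algebra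
  ultimately have D2: "D (D (Affine 0 0)) = Affine x4 y4" unfolding D1 X by metis
  have P4: "Affine x4 y4 \<in> points F" using D2 P2 D1 point_add_closed unfolding D_def by metis
  then have on: "y4^2 + a1 F * x4 * y4 + a3 F * y4 = x4^3 + a2 F * x4^2"
    using F by (simp add: points_def weierstrass_poly_def)
  have D3: "D (Affine x4 y4) = Affine 0 (- a3 F)" using D(1) D2 by simp
  define m where "m = slope F x4 y4 x4 y4"
  have "\<not> (x4 = x4 \<and> y4 = - y4 - a1 F * x4 - a3 F)" using D3 unfolding D_def by auto
  from point_add_slope[OF this m_def[symmetric] refl refl]
  have m: "m^2 + a1 F * m - a2 F - x4 - x4 = 0" "m * x4 = y4"
    using D3 unfolding D_def by auto
  show x4nz: "x4 \<noteq> 0" using D(4) D2 m(2) by auto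
  have "x4^3 = - (a3 F * y4)" using m on by algebra
  then show "x4^3 = a3 F * k * (x4 + a2 F)" unfolding y4_def by simp
qed

text \<open>Here \<open>\<alpha>\<close>, \<open>\<beta>\<close>, \<open>\<gamma>\<close> stand for \<open>a1\<close>, \<open>a2\<close>, \<open>a3\<close>. Scaling by \<open>u = \<gamma> / \<beta>\<close> makes \<open>a2\<close> and \<open>a3\<close>
equal and leads to Tate's normal form \<open>y\<^sup>2 + (1 - c) x y - b y = x\<^sup>3 - b x\<^sup>2\<close>. With
\<open>e = b / c - 1\<close> the relation becomes \<open>e\<^sup>3 = c (c - e)\<close>. This cubic has a double point at the origin,
so the slope \<open>f = c / e\<close> of a line through the origin parametrizes it.\<close>

lemma order_nine_parametrization:
  fixes \<alpha> \<beta> \<gamma> k x4 :: "'a :: field"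
  assumes nz: "\<beta> \<noteq> 0" "\<gamma> \<noteq> 0" "\<alpha> * \<beta> - \<gamma> \<noteq> 0" "x4 \<noteq> 0"
    and k: "k = \<beta>^2 / (\<alpha> * \<beta> - \<gamma>)" and x4: "x4 = k^2 - \<alpha> * k + \<beta>"
    and rel: "x4^3 = \<gamma> * k * (x4 + \<beta>)"
  obtains u f b c where "u \<noteq> 0" "c = f^2 * (f - 1)" "b = c * (f^2 - f + 1)"
    "\<alpha> = u * (1 - c)" "\<beta> = - (u^2 * b)" "\<gamma> = - (u^3 * b)"
proof -
  define u where "u = \<gamma> / \<beta>"
  have u: "u \<noteq> 0" using nz by (simp add: u_def)
  define c where "c = 1 - \<alpha> / u"
  define b where "b = - \<beta> / u^2"
  have \<beta>: "\<beta> = - (u^2 * b)" using u by (simp add: b_def)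
  have \<alpha>: "\<alpha> = u * (1 - c)" using u by (simp add: c_def)
  have "\<gamma> = u * \<beta>" using nz by (simp add: u_def)
  then have \<gamma>: "\<gamma> = - (u^3 * b)" unfolding \<beta> by algebra
  have y2: "\<alpha> * \<beta> - \<gamma> = u^3 * (b * c)" unfolding \<alpha> \<beta> \<gamma> by algebra
  have b: "b \<noteq> 0" and c: "c \<noteq> 0" using nz(3) unfolding y2 by auto
  define e where "e = b / c - 1"
  have bc: "b = c * (e + 1)" using c by (simp add: e_def)
  have e1: "e + 1 \<noteq> 0" using b bc by auto
  have k': "k = u * (e + 1)"
  proof -
    have "k * (u^3 * (b * c)) = (u^2 * b)^2"
      using b c u unfolding k y2 \<beta>[symmetric] by (simp add: \<beta>)
    then have "(u^3 * b * c) * (k - u * (e + 1)) = 0" unfolding bc by algebra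
    then show ?thesis using u b c by simp
  qed
  have x4': "x4 = u^2 * (e * (e + 1))"
    unfolding x4 k' \<alpha> \<beta> bc by algebra
  have e: "e \<noteq> 0" using nz(4) x4' by auto
  have "(u^6 * (e + 1)^3) * (e^3 - c * (c - e)) = 0"
    using rel unfolding x4' k' \<gamma> \<beta> bc by algebra
  then have rel': "e^3 = c * (c - e)" using u e1 by simp
  define f where "f = c / e"
  have cf: "c = f * e" using e by (simp add: f_def)
  have "e^2 * (e - (f^2 - f)) = 0" using rel' unfolding cf by algebra
  then have ef: "e = f^2 - f" using e by simp
  show thesis
  proof (rule that[OF u _ _ \<alpha> \<beta> \<gamma>])
    show "c = f^2 * (f - 1)" unfolding cf ef by algebra
    show "b = c * (f^2 - f + 1)" unfolding bc ef by simp
  qed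
qed

lemma discriminant_order_nine:
  fixes F :: "'a :: field weierstrass"
  assumes c: "c = f^2 * (f - 1)" and b: "b = c * (f^2 - f + 1)"
    and F: "a1 F = u * (1 - c)" "a2 F = - (u^2 * b)" "a3 F = - (u^3 * b)" "a4 F = 0" "a6 F = 0"
  shows "discriminant F = u^12 * (f * (f - 1))^9 * (f^2 - f + 1)^3 * (f^3 - 6 * f^2 + 3 * f + 1)"
proof -
  define g where "g = f^2 - f + 1"
  have "discriminant F = u^12 * (b^3 * ((1 - c)^4 - (1 - c)^3 - 8 * b * (1 - c)^2 + 36 * b * (1 - c) + 16 * b^2 - 27 * b))"
    unfolding discriminant_def Let_def F by (simp add: algebra_simps power2_eq_square power3_eq_cube power4_eq_xxxx eval_nat_numeral)
  also have "b^3 * ((1 - c)^4 - (1 - c)^3 - 8 * b * (1 - c)^2 + 36 * b * (1 - c) + 16 * b^2 - 27 * b)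
      = c^4 * g^3 * (- ((1 - c)^3) - 8 * g * (1 - c)^2 + 36 * g * (1 - c) + 16 * c * g^2 - 27 * g)"
    unfolding b g_def[symmetric] by algebra
  also have "- ((1 - c)^3) - 8 * g * (1 - c)^2 + 36 * g * (1 - c) + 16 * c * g^2 - 27 * g
      = f * (f - 1)^5 * (f^3 - 6 * f^2 + 3 * f + 1)"
    unfolding c g_def by algebra
  also have "u^12 * (c^4 * g^3 * (f * (f - 1)^5 * (f^3 - 6 * f^2 + 3 * f + 1)))
      = u^12 * (f * (f - 1))^9 * g^3 * (f^3 - 6 * f^2 + 3 * f + 1)"
    unfolding c by algebra
  finally show ?thesis unfolding g_def .
qed

text \<open>With \<open>g = f (f - 1)\<close> and \<open>t = z + 3\<close>, the factors of \<open>z\<^sup>3 - 27 = (t - 6) (t\<^sup>2 - 3 t + 9)\<close> are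
\<open>(f\<^sup>3 - 6 f\<^sup>2 + 3 f + 1) / g\<close> and \<open>(f\<^sup>2 - f + 1)\<^sup>3 / g\<^sup>2\<close>, so the product on the left is
\<open>z\<^sup>3 - 27\<close> times \<open>(u g)\<^sup>1\<^sup>2\<close>.\<close>

lemma order_nine_discriminant_not_square:
  fixes u f :: rat
  assumes "u^12 * (f * (f - 1))^9 * (f^2 - f + 1)^3 * (f^3 - 6 * f^2 + 3 * f + 1) = d^2"
  shows "d = 0"
proof (rule ccontr)
  assume d: "d \<noteq> 0"
  define g where "g = f * (f - 1)"
  have g: "g \<noteq> 0" and u: "u \<noteq> 0" using assms d by (auto simp: g_def)
  define z where "z = (f^3 - 3 * f + 1) / g - 3"
  have zg: "z * g = f^3 - 3 * f^2 + 1" using g unfolding z_def by (simp add: left_diff_distrib) (simp add: g_def algebra_simps power2_eq_square)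
  have "(u * g)^12 * (z^3 - 27) = u^12 * g^9 * ((z * g)^3 - 27 * g^3)" by algebra
  also have "\<dots> = u^12 * g^9 * ((f^2 - f + 1)^3 * (f^3 - 6 * f^2 + 3 * f + 1))"
    unfolding zg unfolding g_def by algebra
  also have "\<dots> = d^2" using assms unfolding g_def by (simp add: ac_simps)
  finally have "(d / (u * g)^6)^2 = z^3 - 27"
    using u g by (simp add: power_divide field_simps flip: power_mult)
  then have "d / (u * g)^6 = 0" by (rule rational_square_eq_cube_minus_27)
  with d u g show False by simp
qed

section \<open>The discriminant of a curve with torsion of order 9\<close>

theorem proposition4:
  fixes E :: "rat weierstrass" and A B :: int
  assumes "elliptic_curve E"
    and "torsion_subgroup E \<cong> integer_mod_group 9"
    and "is_short_model E A B"
  shows "\<not> is_square (of_int (short_discriminant A B) :: rat)"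
proof
  assume "is_square (of_int (short_discriminant A B) :: rat)"
  then have "is_square (discriminant E)" using short_model_square_iff[OF assms(3)] by simp
  then obtain d where d: "discriminant E = d^2" by (auto elim: is_nth_powerE)
  obtain P where P: "P \<in> points E"
    and dbl: "point_add E (point_add E (point_add E P P) (point_add E P P))
                (point_add E (point_add E P P) (point_add E P P)) = point_neg E P"
      "point_add E P P \<noteq> point_neg E P" "point_add E P P \<noteq> Infinity"
      "point_add E (point_add E P P) (point_add E P P) \<noteq> Infinity"
      "point_add E (point_add E P P) (point_add E P P) \<noteq> P"
    using torsion_C9_doubling_cycle[OF assms(1,2)] by blast
  have "P \<noteq> Infinity" using dbl(3) by auto
  then obtain x y where xy: "P = Affine x y" by (cases P) auto
  with P have "Affine x y \<in> points E" by simp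
  with assms(1) show False
  proof (cases rule: normalize_at_point)
    case (1 s F)
    \<comment> \<open>The conditions on the doubles of \<open>P\<close> are carried over to the doubles of the origin.\<close>
    let ?sh = "shift_point x s y"
    define D where "D = (\<lambda>R. point_add F R R)"
    have P0: "P = ?sh (Affine 0 0)" by (simp add: xy)
    have O: "Affine 0 0 \<in> points F" using 1 by (simp add: points_origin)
    have D: "D R \<in> points F" "point_add E (?sh R) (?sh R) = ?sh (D R)" if "R \<in> points F" for R
      using that unfolding D_def 1(1) by (auto intro: point_add_closed point_add_shift)
    have neg: "point_neg E P = ?sh (Affine 0 (- a3 F))"
      unfolding xy 1(1) by (simp add: shift_curve_def algebra_simps)
    have inj: "?sh R = ?sh S \<longleftrightarrow> R = S" for R S
      by (cases R; cases S) auto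
    have inf: "?sh R = Infinity \<longleftrightarrow> R = Infinity" for R by (cases R) auto
    note dbl' = dbl[unfolded neg, unfolded P0, unfolded D(2)[OF O] D(2)[OF D(1)[OF O]]
        D(2)[OF D(1)[OF D(1)[OF O]]] inj inf, unfolded D_def]
    define k where "k = a2 F ^ 2 / (a1 F * a2 F - a3 F)"
    define x4 where "x4 = k^2 - a1 F * k + a2 F"
    note rel = order_nine_relation[OF 1(4,2,3) dbl'(1,2,4,5) k_def x4_def]
    obtain u f b c where uf: "u \<noteq> 0" "c = f^2 * (f - 1)" "b = c * (f^2 - f + 1)"
        "a1 F = u * (1 - c)" "a2 F = - (u^2 * b)" "a3 F = - (u^3 * b)"
      using order_nine_parametrization[OF rel(1) 1(3) rel(2,3) k_def x4_def rel(4)] .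
    have "discriminant F = d^2" unfolding 1(1) discriminant_shift by (rule d)
    then have "d = 0"
      using order_nine_discriminant_not_square discriminant_order_nine[OF uf(2-6) 1(4,2)] by metis
    with d assms(1) show False by (simp add: elliptic_curve_def)
  next
    case (2 s F)
    have "a3 E + x * a1 E + 2 * y = 0" using 2(3) unfolding 2(1) by (simp add: shift_curve_def)
    then have "y = - y - a1 E * x - a3 E" by (simp add: algebra_simps add_eq_0_iff)
    then have "point_add E P P = Infinity" unfolding xy by simp
    with dbl(3) show False by simp
  qed
qed

end
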